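(* Let $\mathbb Y=\mathbb R^m$, $g\colon\mathbb X\to\mathbb R^m$ twice continuously differentiable, $D\subset\mathbb R^m$ closed and polyhedral locally around $g(\bar x)$, $\Phi(x):=g(x)-D$, $(\bar x,0)\in\operatorname{gph}\Phi$, $u\in\mathbb S_{\mathbb X}$. Set $\mathbf T(u):=\mathcal T_{\mathcal T_D(g(\bar x))}(\nabla g(\bar x)u)$ and, for $s\in\mathbb X$, $v\in\mathbb R^m$, $w_s(u,v):=\nabla g(\bar x)s+\tfrac12\nabla^2g(\bar x)[u,u]-v$. Assume that for each $s\in\mathbb X$: if $\nabla g(\bar x)^*y^*=0$, $\nabla^2\langle y^*,g\rangle(\bar x)(u)+\nabla g(\bar x)^*z^*=0$, $y^*\in\mathcal N_{\mathbf T(u)}(w_s(u,0))$, $z^*\in\mathcal T_{\mathcal N_{\mathbf T(u)}(w_s(u,0))}(y^* )$, then $y^*=0$. Consider the system (S''): $\langle y^*,v\rangle\ge0$, $x^*=\nabla^2\langle y^*,g\rangle(\bar x)(u)+\nabla g(\bar x)^*z^*$, $y^*\in\mathcal N_{\mathbf T(u)}(w_s(u,v))\cap\ker\nabla g(\bar x)^*$, $z^*\in\mathcal T_{\mathcal N_{\mathbf T(u)}(w_s(u,v))}(y^* )$. (i) If for every $x^*,s\in\mathbb X$ and $y^*,z^*,v\in\mathbb R^m$ satisfying (S'') there is $\lambda\in\mathcal N_D(g(\bar x))$ with $x^*=\nabla g(\bar x)^*\lambda$, then $\Phi$ is asymptotically regular at $(\bar x,0)$ in direction $u$. (ii) If for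 every such data there is $\lambda\in\mathcal N_{\mathcal T_D(g(\bar x))}(\nabla g(\bar x)u)$ with $x^*=\nabla g(\bar x)^*\lambda$, then $\Phi$ is strongly asymptotically regular at $(\bar x,0)$ in direction $u$.
   Context: $\nabla^2g(\bar x)[u,u]=\sum_i\langle u,\nabla^2\langle e_i,g\rangle(\bar x)u\rangle e_i$ for the canonical basis $\{e_i\}$; $\nabla^2\langle y^*,g\rangle(\bar x)(u)$ the Hessian of $x\mapsto\langle y^*,g(x)\rangle$ applied to $u$. $D$ polyhedral locally around $y$: $D\cap V$ is a finite union of convex polyhedra for a neighbourhood $V$ of $y$. $\mathcal T_Q$ Bouligand tangent cone, $\mathcal N_Q$ limiting normal cone. (Strong) asymptotic regularity in direction $u$ at $(\bar x,\bar y)$: for all $\{(x_k,y_k)\}\subset\operatorname{gph}\Phi$, $\{x_k^*\}$, $\{\lambda_k\}$, $x^*,y^*$ with $x_k\notin\Phi^{-1}(\bar y)$, $y_k\ne\bar y$, $x_k^*\in\widehat D^*\Phi(x_k,y_k)(\lambda_k)$ (regular coderivative), $x_k\to\bar x$, $y_k\to\bar y$, $x_k^*\to x^*$, $(x_k-\bar x)/\|x_k-\bar x\|\to u$, $(y_k-\bar y)/\|x_k-\bar x\|\to0$, $\|\lambda_k\|\to\infty$, $(y_k-\bar y)/\|y_k-\bar y\|-\lambda_k/\|\lambda_k\|\to0$, $(\|y_k-\bar y\|/\|x_k-\bar x\|)\lambda_k\to y^*$, one has $x^*\in\operatorname{Im}D^*\Phi(\bar x,\bar y)$ (limiting coderivative;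 resp. $x^*\in\operatorname{Im}D^*\Phi((\bar x,\bar y);(u,0))$, directional limiting coderivative, for strong), $\operatorname{Im}\Psi=\bigcup_z\Psi(z)$. *)

theory Defs
  imports "HOL-Analysis.Analysis"
begin

definition tangent_cone :: "'a::real_normed_vector set \<Rightarrow> 'a \<Rightarrow> 'a set" where
  "tangent_cone Q x = {d. \<exists>t dd. (\<forall>k. t k > 0) \<and> t \<longlonglongrightarrow> 0 \<and> dd \<longlonglongrightarrow> d
        \<and> (\<forall>k. x + t k *\<^sub>R dd k \<in> Q)}"

definition reg_normal_cone :: "'a::real_inner set \<Rightarrow> 'a \<Rightarrow> 'a set" where
  "reg_normal_cone Q x = {v. x \<in> Q \<and> (\<forall>e>0. \<exists>d>0. \<forall>y\<in>Q. dist y x < d \<longrightarrow>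
        inner v (y - x) \<le> e * norm (y - x))}"

definition lim_normal_cone :: "'a::real_inner set \<Rightarrow> 'a \<Rightarrow> 'a set" where
  "lim_normal_cone Q x = {v. x \<in> Q \<and> (\<exists>xs vs. (\<forall>k. xs k \<in> Q) \<and> xs \<longlonglongrightarrow> x \<and> vs \<longlonglongrightarrow> v
        \<and> (\<forall>k. vs k \<in> reg_normal_cone Q (xs k)))}"

definition dir_normal_cone :: "'a::real_inner set \<Rightarrow> 'a \<Rightarrow> 'a \<Rightarrow> 'a set" where
  "dir_normal_cone Q x d = {v. \<exists>t ds vs. (\<forall>k. t k > 0) \<and> t \<longlonglongrightarrow> 0 \<and> ds \<longlonglongrightarrow> d
        \<and> vs \<longlonglongrightarrow> v \<and> (\<forall>k. vs k \<in> reg_normal_cone Q (x + t k *\<^sub>R ds k))}"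

definition gph :: "('a \<Rightarrow> 'b set) \<Rightarrow> ('a \<times> 'b) set" where
  "gph \<Phi> = {(x, y). y \<in> \<Phi> x}"

definition reg_coderiv :: "('a::real_inner \<Rightarrow> 'b::real_inner set) \<Rightarrow> 'a \<Rightarrow> 'b \<Rightarrow> 'b \<Rightarrow> 'a set" where
  "reg_coderiv \<Phi> x y l = {xs. (xs, - l) \<in> reg_normal_cone (gph \<Phi>) (x, y)}"

definition lim_coderiv :: "('a::real_inner \<Rightarrow> 'b::real_inner set) \<Rightarrow> 'a \<Rightarrow> 'b \<Rightarrow> 'b \<Rightarrow> 'a set" where
  "lim_coderiv \<Phi> x y l = {xs. (xs, - l) \<in> lim_normal_cone (gph \<Phi>) (x, y)}"

definition dir_coderiv :: "('a::real_inner \<Rightarrow> 'b::real_inner set) \<Rightarrow> 'a \<Rightarrow> 'b \<Rightarrow> 'a \<Rightarrow> 'b \<Rightarrow> 'b \<Rightarrow> 'a set" where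
  "dir_coderiv \<Phi> x y u v l = {xs. (xs, - l) \<in> dir_normal_cone (gph \<Phi>) (x, y) (u, v)}"

definition asym_seq_data ::
  "('a::real_inner \<Rightarrow> 'b::real_inner set) \<Rightarrow> 'a \<Rightarrow> 'b \<Rightarrow> 'a \<Rightarrow>
   (nat \<Rightarrow> 'a) \<Rightarrow> (nat \<Rightarrow> 'b) \<Rightarrow> (nat \<Rightarrow> 'a) \<Rightarrow> (nat \<Rightarrow> 'b) \<Rightarrow> 'a \<Rightarrow> 'b \<Rightarrow> bool" where
  "asym_seq_data \<Phi> xb yb u xk yk xsk lk xst yst \<longleftrightarrow>
     (\<forall>k. yk k \<in> \<Phi> (xk k)) \<and> (\<forall>k. yb \<notin> \<Phi> (xk k)) \<and> (\<forall>k. yk k \<noteq> yb)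
   \<and> (\<forall>k. xsk k \<in> reg_coderiv \<Phi> (xk k) (yk k) (lk k))
   \<and> xk \<longlonglongrightarrow> xb \<and> yk \<longlonglongrightarrow> yb \<and> xsk \<longlonglongrightarrow> xst
   \<and> (\<lambda>k. (1 / norm (xk k - xb)) *\<^sub>R (xk k - xb)) \<longlonglongrightarrow> u
   \<and> (\<lambda>k. (1 / norm (xk k - xb)) *\<^sub>R (yk k - yb)) \<longlonglongrightarrow> 0
   \<and> filterlim (\<lambda>k. norm (lk k)) at_top sequentially
   \<and> (\<lambda>k. (1 / norm (yk k - yb)) *\<^sub>R (yk k - yb) - (1 / norm (lk k)) *\<^sub>R lk k) \<longlonglongrightarrow> 0
   \<and> (\<lambda>k. (norm (yk k - yb) / norm (xk k - xb)) *\<^sub>R lk k) \<longlonglongrightarrow> yst"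

definition asym_regular :: "('a::real_inner \<Rightarrow> 'b::real_inner set) \<Rightarrow> 'a \<Rightarrow> 'b \<Rightarrow> 'a \<Rightarrow> bool" where
  "asym_regular \<Phi> xb yb u \<longleftrightarrow> (\<forall>xk yk xsk lk xst yst.
      asym_seq_data \<Phi> xb yb u xk yk xsk lk xst yst \<longrightarrow>
      xst \<in> (\<Union>l. lim_coderiv \<Phi> xb yb l))"

definition strong_asym_regular :: "('a::real_inner \<Rightarrow> 'b::real_inner set) \<Rightarrow> 'a \<Rightarrow> 'b \<Rightarrow> 'a \<Rightarrow> bool" where
  "strong_asym_regular \<Phi> xb yb u \<longleftrightarrow> (\<forall>xk yk xsk lk xst yst.
      asym_seq_data \<Phi> xb yb u xk yk xsk lk xst yst \<longrightarrow>
      xst \<in> (\<Union>l. dir_coderiv \<Phi> xb yb u 0 l))"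

definition polyhedral_near :: "'a::euclidean_space set \<Rightarrow> 'a \<Rightarrow> bool" where
  "polyhedral_near D y \<longleftrightarrow> (\<exists>V P. y \<in> interior V \<and> finite P \<and> (\<forall>p\<in>P. polyhedron p)
        \<and> D \<inter> V = \<Union>P)"

text \<open>Hessian of x \<mapsto> <y, g x> (second derivative H of g at the point) applied to u:
  the vector \<Sum>_i <y, H[u, e_i]> e_i.\<close>
definition hess_apply :: "('a::euclidean_space \<Rightarrow>\<^sub>L 'a \<Rightarrow>\<^sub>L 'b::real_inner) \<Rightarrow> 'b \<Rightarrow> 'a \<Rightarrow> 'a" where
  "hess_apply H y u = (\<Sum>i\<in>Basis. inner y (blinfun_apply (blinfun_apply H u) i) *\<^sub>R i)"

end

theory Submission
  imports Defs
begin

text \<open>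
  Near \<open>g xb\<close> the set \<open>D\<close> coincides with its tangent cone \<open>C\<close>, and near \<open>p = G u\<close> the cone \<open>C\<close>
  coincides with \<open>p + T\<close>; membership in \<open>C\<close> and \<open>T\<close> depends only on the signs of finitely many linear
  functionals. A regular normal \<open>\<lambda>\<close> of \<open>D\<close> at \<open>g x - y\<close> is therefore a regular normal of \<open>T\<close> at the
  rescaled point \<open>W = G s + r - y / t\<^sup>2\<close>, where \<open>t = norm (x - xb)\<close> and \<open>r\<close> tends to half the second
  derivative of \<open>g\<close> in direction \<open>u\<close>. On a subsequence the sign pattern of \<open>W\<close> is constant, so that all
  \<open>\<lambda>\<close> lie in one polyhedral cone \<open>K\<close>. If \<open>t \<lambda>\<close> is unbounded, its normalised limit contradicts the
  qualification condition. If \<open>t \<lambda> \<longlonglongrightarrow> m\<close>, then expanding the derivative of \<open>g\<close> to first order and using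
  that linear images of polyhedra are closed yields the second multiplier as a tangent to \<open>K\<close> at \<open>m\<close>.
\<close>

section \<open>Sign-determined sets\<close>

text \<open>Two sequences resist a direct passage to the limit. The points \<open>W\<close> involve
  \<open>((x - xb) / t - u) / t\<close> and \<open>y / t^2\<close>, neither of which has to stay
  bounded, and the multipliers diverge. Compactness is therefore replaced by finiteness: along one
  sign pattern the normal cone is frozen even if \<open>W\<close> escapes to infinity, and where a
  limit point is still required, closedness of a polyhedral image supplies it. The two cases use
  \<open>s\<close> and \<open>v\<close> differently. The qualification condition has
  \<open>v = 0\<close>, so in the unbounded case \<open>y / t^2\<close> must be shown to vanish and
  a genuine \<open>s\<close> must be produced. The system (S'') leaves \<open>v\<close> free up to
  its sign condition; there \<open>s = 0\<close> and a \<open>v\<close> that turns one of the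
  \<open>W\<close> into the base point suffice, and the sign condition follows from the asymptotic
  alignment of \<open>y\<close> with its multiplier. The multiplier \<open>ys\<close> of the system
  is the limit of \<open>t \<lambda>\<close>, not the limit \<open>yst\<close> of the data, which
  serves to force \<open>y / t^2\<close> to zero.\<close>

definition same_signs :: "'a::real_inner set \<Rightarrow> 'a \<Rightarrow> 'a \<Rightarrow> bool" where
  "same_signs A x y \<longleftrightarrow> (\<forall>a\<in>A. sgn (inner a x) = sgn (inner a y))"

text \<open>Unions of cells of the central hyperplane arrangement given by \<open>A\<close>. Unlike
  a list of convex pieces, this description survives the passage to tangent cones with the same
  \<open>A\<close>.\<close>

definition sign_determined :: "'a::real_inner set \<Rightarrow> 'a set \<Rightarrow> bool" where
  "sign_determined A T \<longleftrightarrow> (\<forall>x y. same_signs A x y \<longrightarrow> (x \<in> T \<longleftrightarrow> y \<in> T))"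

lemma sign_determinedD:
  "sign_determined A T \<Longrightarrow> same_signs A x y \<Longrightarrow> x \<in> T \<longleftrightarrow> y \<in> T"
  unfolding sign_determined_def by blast

lemma same_signs_scaleR: "t > 0 \<Longrightarrow> same_signs A (t *\<^sub>R x) x"
  unfolding same_signs_def by (simp add: sgn_mult)

lemma sign_determined_scaleR_iff:
  "sign_determined A T \<Longrightarrow> t > 0 \<Longrightarrow> t *\<^sub>R x \<in> T \<longleftrightarrow> x \<in> T"
  by (blast dest: sign_determinedD same_signs_scaleR)

lemma sgn_inner_locally_constant:
  fixes y :: "'a::real_inner"
  assumes "finite S"
  shows "\<exists>d>0. \<forall>h. norm h < d \<longrightarrow>
    (\<forall>a b. (a, b) \<in> S \<longrightarrow> inner a y \<noteq> b \<longrightarrow> sgn (inner a (y + h) - b) = sgn (inner a y - b))"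
proof -
  have "\<forall>\<^sub>F h in nhds 0. inner a y \<noteq> b \<longrightarrow> sgn (inner a (y + h) - b) = sgn (inner a y - b)" for a b
  proof -
    have "((\<lambda>h. inner a (y + h) - b) \<longlongrightarrow> inner a (y + 0) - b) (nhds 0)"
      by (intro tendsto_intros filterlim_ident)
    then have L: "((\<lambda>h. inner a (y + h) - b) \<longlongrightarrow> inner a y - b) (nhds 0)" by simp
    consider "inner a y - b > 0" | "inner a y - b < 0" | "inner a y = b" by linarith
    then show ?thesis
    proof cases
      case 1
      show ?thesis using order_tendstoD(1)[OF L 1] by eventually_elim (use 1 in simp)
    next
      case 2
      show ?thesis using order_tendstoD(2)[OF L 2] by eventually_elim (use 2 in simp)
    qed simp
  qed
  then have "\<forall>\<^sub>F h in nhds 0. \<forall>p\<in>S. inner (fst p) y \<noteq> snd p \<longrightarrow>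
      sgn (inner (fst p) (y + h) - snd p) = sgn (inner (fst p) y - snd p)"
    using assms by (simp add: eventually_ball_finite_distrib)
  then show ?thesis
    by (force simp: eventually_nhds_metric dist_norm)
qed

lemma tangent_cone_scaleR:
  assumes "h \<in> tangent_cone Q y" "c > 0"
  shows "c *\<^sub>R h \<in> tangent_cone Q y"
proof -
  obtain t dd where t: "\<forall>k. t k > 0" "t \<longlonglongrightarrow> 0" "dd \<longlonglongrightarrow> h" "\<forall>k. y + t k *\<^sub>R dd k \<in> Q"
    using assms(1) unfolding tangent_cone_def by blast
  have "(\<lambda>k. t k / c) \<longlonglongrightarrow> 0" using tendsto_divide[OF t(2) tendsto_const, of c] assms(2) by simp
  moreover have "(\<lambda>k. c *\<^sub>R dd k) \<longlonglongrightarrow> c *\<^sub>R h" by (intro tendsto_intros t)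
  moreover have "\<forall>k. t k / c > 0" "\<forall>k. y + (t k / c) *\<^sub>R (c *\<^sub>R dd k) \<in> Q"
    using t(1,4) assms(2) by (simp_all del: divide_const_simps)
  ultimately show ?thesis
    unfolding tangent_cone_def by (intro CollectI exI[of _ "\<lambda>k. t k / c"] exI[of _ "\<lambda>k. c *\<^sub>R dd k"] conjI)
qed

text \<open>Near \<open>y\<close> the hyperplanes of \<open>S\<close> that miss \<open>y\<close>
  have constant sign, so membership of \<open>y + h\<close> depends on the signs of
  \<open>inner a h\<close> for the hyperplanes through \<open>y\<close>. These signs ignore positive
  scaling of \<open>h\<close>, which makes \<open>Q\<close> conic around \<open>y\<close>. Affine
  hyperplanes and a neighbourhood \<open>V\<close> are allowed so that one statement covers
  \<open>D\<close> as well as cones.\<close>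

lemma tangent_cone_locally_sign_determined:
  fixes Q :: "'a::real_inner set"
  assumes Q: "closed Q" and S: "finite S" and V: "y \<in> interior V"
    and det: "\<And>x x'. x \<in> V \<Longrightarrow> x' \<in> V \<Longrightarrow>
        (\<And>a b. (a, b) \<in> S \<Longrightarrow> sgn (inner a x - b) = sgn (inner a x' - b)) \<Longrightarrow> x \<in> Q \<longleftrightarrow> x' \<in> Q"
  shows "\<exists>d>0. \<forall>h. norm h < d \<longrightarrow> (y + h \<in> Q \<longleftrightarrow> h \<in> tangent_cone Q y)"
    and "sign_determined {a. (a, inner a y) \<in> S} (tangent_cone Q y)"
    and "closed (tangent_cone Q y)"
proof -
  let ?A = "{a. (a, inner a y) \<in> S}" and ?T = "tangent_cone Q y"
  obtain d1 where d1: "d1 > 0" "\<And>h a b. norm h < d1 \<Longrightarrow> (a, b) \<in> S \<Longrightarrow> inner a y \<noteq> b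
      \<Longrightarrow> sgn (inner a (y + h) - b) = sgn (inner a y - b)"
    using sgn_inner_locally_constant[OF S, of y] by blast
  obtain d2 where d2: "d2 > 0" "ball y d2 \<subseteq> V"
    using V by (auto simp: mem_interior)
  define d where "d = min d1 d2"
  have d: "d > 0" using d1 d2 by (simp add: d_def)
  have local: "y + h \<in> Q \<longleftrightarrow> y + h' \<in> Q"
    if "norm h < d" "norm h' < d" "same_signs ?A h h'" for h h'
  proof (rule det)
    show "y + h \<in> V" "y + h' \<in> V"
      using that d2 by (auto simp: d_def dist_norm subset_eq)
    show "sgn (inner a (y + h) - b) = sgn (inner a (y + h') - b)" if ab: "(a, b) \<in> S" for a b
    proof (cases "inner a y = b")
      case True
      then show ?thesis using that \<open>same_signs ?A h h'\<close>
        by (auto simp: same_signs_def inner_right_distrib)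
    next
      case False
      then show ?thesis using d1(2) ab \<open>norm h < d\<close> \<open>norm h' < d\<close> by (simp add: d_def)
    qed
  qed
  have loc: "y + h \<in> Q \<longleftrightarrow> h \<in> ?T" if h: "norm h < d" for h
  proof
    assume Qh: "y + h \<in> Q"
    have "y + (1 / real (Suc k)) *\<^sub>R h \<in> Q" for k
    proof -
      have "norm ((1 / real (Suc k)) *\<^sub>R h) \<le> norm h"
        by (simp add: divide_le_eq mult_le_cancel_left1)
      then show ?thesis
        using local[of "(1 / real (Suc k)) *\<^sub>R h" h] h same_signs_scaleR[of "1 / real (Suc k)"] Qh by auto
    qed
    moreover have "(\<lambda>k. 1 / real (Suc k)) \<longlonglongrightarrow> 0"
      using LIMSEQ_inverse_real_of_nat by (simp add: inverse_eq_divide)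
    ultimately show "h \<in> ?T"
      unfolding tangent_cone_def
      by (intro CollectI exI[of _ "\<lambda>k. 1 / real (Suc k)"] exI[of _ "\<lambda>k. h"] conjI) simp_all
  next
    assume "h \<in> ?T"
    then obtain t dd where t: "\<forall>k. t k > 0" "t \<longlonglongrightarrow> 0" "dd \<longlonglongrightarrow> h" "\<forall>k. y + t k *\<^sub>R dd k \<in> Q"
      unfolding tangent_cone_def by blast
    have "(\<lambda>k. norm (t k *\<^sub>R dd k)) \<longlonglongrightarrow> norm (0 *\<^sub>R h)" by (intro tendsto_intros t)
    then have "\<forall>\<^sub>F k in sequentially. norm (t k *\<^sub>R dd k) < d"
      using d by (intro order_tendstoD(2)[where y = "norm (0 *\<^sub>R h)"]) auto
    moreover have "\<forall>\<^sub>F k in sequentially. norm (dd k) < d"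
      using h by (intro order_tendstoD(2)[OF tendsto_norm[OF t(3)]]) auto
    ultimately have "\<forall>\<^sub>F k in sequentially. y + dd k \<in> Q"
    proof eventually_elim
      case (elim k)
      then show ?case using local[of "t k *\<^sub>R dd k" "dd k"] same_signs_scaleR[of "t k"] t by blast
    qed
    moreover have "(\<lambda>k. y + dd k) \<longlonglongrightarrow> y + h" by (intro tendsto_intros t)
    ultimately show "y + h \<in> Q"
      by (rule Lim_in_closed_set[OF Q _ trivial_limit_sequentially])
  qed
  then show "\<exists>d>0. \<forall>h. norm h < d \<longrightarrow> (y + h \<in> Q \<longleftrightarrow> h \<in> ?T)" using d by blast
  have cone: "c *\<^sub>R h \<in> ?T \<longleftrightarrow> h \<in> ?T" if "c > 0" for c h
    using tangent_cone_scaleR[of h Q y c] tangent_cone_scaleR[of "c *\<^sub>R h" Q y "1/c"] that by auto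
  \<comment> \<open>A common factor brings two arbitrary vectors into the ball where
    \<open>local\<close> applies; the summand 1 avoids division by zero.\<close>
  have small: "\<exists>c>0. norm (c *\<^sub>R h) < d \<and> norm (c *\<^sub>R h') < d" for h h' :: 'a
  proof -
    let ?c = "d / (norm h + norm h' + 1)"
    have n: "norm h + norm h' + 1 > 0" by (simp add: add_nonneg_pos)
    have "?c * norm h < d" "?c * norm h' < d" using d n
      by (auto simp: divide_less_eq mult_less_cancel_left_disj add_nonneg_pos add_pos_nonneg add.commute)
    then show ?thesis using d n by (intro exI[of _ ?c]) auto
  qed
  show "sign_determined ?A ?T"
    unfolding sign_determined_def
  proof (intro allI impI)
    fix h h' assume ss: "same_signs ?A h h'"
    obtain c where c: "c > 0" "norm (c *\<^sub>R h) < d" "norm (c *\<^sub>R h') < d" using small by blast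
    have "same_signs ?A (c *\<^sub>R h) (c *\<^sub>R h')"
      using ss c(1) by (simp add: same_signs_def sgn_mult)
    then show "h \<in> ?T \<longleftrightarrow> h' \<in> ?T"
      using local[OF c(2,3)] loc[OF c(2)] loc[OF c(3)] cone[OF c(1)] by blast
  qed
  show "closed ?T"
    unfolding closed_sequential_limits
  proof (intro allI impI, elim conjE)
    fix x l assume x: "\<forall>n. x n \<in> ?T" "x \<longlonglongrightarrow> l"
    obtain c where c: "c > 0" "norm (c *\<^sub>R l) < d" using small by blast
    have L: "(\<lambda>n. c *\<^sub>R x n) \<longlonglongrightarrow> c *\<^sub>R l" by (intro tendsto_intros x)
    have "\<forall>\<^sub>F n in sequentially. norm (c *\<^sub>R x n) < d"
      using order_tendstoD(2)[OF tendsto_norm[OF L] c(2)] .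
    then have "\<forall>\<^sub>F n in sequentially. y + c *\<^sub>R x n \<in> Q"
      by eventually_elim (use loc cone c x in blast)
    moreover have "(\<lambda>n. y + c *\<^sub>R x n) \<longlonglongrightarrow> y + c *\<^sub>R l" by (intro tendsto_intros L)
    ultimately have "y + c *\<^sub>R l \<in> Q"
      by (rule Lim_in_closed_set[OF Q _ trivial_limit_sequentially])
    then show "l \<in> ?T" using loc[OF c(2)] cone[OF c(1)] by blast
  qed
qed

lemma tangent_cone_polyhedral_near:
  assumes "closed D" "polyhedral_near D y"
  obtains A where "finite A" "sign_determined A (tangent_cone D y)" "closed (tangent_cone D y)"
    "\<exists>d>0. \<forall>h. norm h < d \<longrightarrow> (y + h \<in> D \<longleftrightarrow> h \<in> tangent_cone D y)"
proof -
  obtain V P where V: "y \<in> interior V" "finite P" "\<And>p. p \<in> P \<Longrightarrow> polyhedron p" "D \<inter> V = \<Union>P"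
    using assms(2) unfolding polyhedral_near_def by blast
  have "\<exists>S. finite S \<and> p = {x. \<forall>a b. (a, b) \<in> S \<longrightarrow> inner a x \<le> b}" if p: "p \<in> P" for p
  proof -
    obtain F where F: "finite F" "p = \<Inter>F" "\<forall>h\<in>F. \<exists>a b. a \<noteq> 0 \<and> h = {x. inner a x \<le> b}"
      using V(3)[OF p] unfolding polyhedron_def by blast
    then obtain al be where ab: "\<forall>h\<in>F. h = {x. inner (al h) x \<le> be h}" by metis
    then have "p = {x. \<forall>a b. (a, b) \<in> (\<lambda>h. (al h, be h)) ` F \<longrightarrow> inner a x \<le> b}"
      unfolding F(2) by blast
    then show ?thesis using F(1) by blast
  qed
  then have "\<exists>S. \<forall>p\<in>P. finite (S p) \<and> p = {x. \<forall>a b. (a, b) \<in> S p \<longrightarrow> inner a x \<le> b}"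
    by (intro bchoice ballI)
  then obtain S where S: "\<forall>p\<in>P. finite (S p) \<and> p = {x. \<forall>a b. (a, b) \<in> S p \<longrightarrow> inner a x \<le> b}"
    by (elim exE)
  \<comment> \<open>The inequalities of all pieces are pooled: equal signs on the pool keep a point
    in whichever piece contains it.\<close>
  define S' where "S' = (\<Union>p\<in>P. S p)"
  have S': "finite S'" using S V by (auto simp: S'_def)
  have le: "inner a x \<le> b \<longleftrightarrow> inner a x' \<le> b" if "sgn (inner a x - b) = sgn (inner a x' - b)" for a x x' b
    using that by (auto simp: sgn_if split: if_splits)
  have imp: "x' \<in> D" if V': "x \<in> V" "x' \<in> V" and xD: "x \<in> D"
      and sg: "\<And>a b. (a, b) \<in> S' \<Longrightarrow> sgn (inner a x - b) = sgn (inner a x' - b)" for x x'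
  proof -
    have "x \<in> \<Union>P" using V(4) V' xD by blast
    then obtain p where p: "p \<in> P" "x \<in> p" by blast
    have pe: "p = {x. \<forall>a b. (a, b) \<in> S p \<longrightarrow> inner a x \<le> b}" by (rule conjunct2[OF bspec[OF S p(1)]])
    have "inner a x' \<le> b" if ab: "(a, b) \<in> S p" for a b
    proof -
      have "inner a x \<le> b" using p(2) ab by (subst (asm) pe) simp
      moreover have "(a, b) \<in> S'" using ab p(1) by (auto simp: S'_def)
      ultimately show ?thesis using le[OF sg] by blast
    qed
    then have "x' \<in> p" by (subst pe) simp
    then have "x' \<in> \<Union>P" using p(1) by blast
    then show ?thesis using V(4) V'(2) by blast
  qed
  have det: "x \<in> D \<longleftrightarrow> x' \<in> D" if "x \<in> V" "x' \<in> V"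
      "\<And>a b. (a, b) \<in> S' \<Longrightarrow> sgn (inner a x - b) = sgn (inner a x' - b)" for x x'
    by (rule iffI) (rule imp[OF that(1,2) _ that(3)] imp[OF that(2,1) _ that(3)[symmetric]]; assumption)+
  note T = tangent_cone_locally_sign_determined[OF assms(1) S' V(1) det]
  have "{a. (a, inner a y) \<in> S'} \<subseteq> fst ` S'" by force
  then have "finite {a. (a, inner a y) \<in> S'}" using S' by (meson finite_imageI finite_subset)
  then show ?thesis using that T by blast
qed

text \<open>For a central arrangement the hyperplanes through \<open>p\<close> form a subfamily of
  \<open>A\<close>, so a single finite \<open>A\<close> serves for a cone, its tangent cone and
  every further iteration.\<close>

lemma tangent_cone_sign_determined:
  assumes "closed C" "finite A" "sign_determined A C"
  shows "sign_determined A (tangent_cone C p)" "closed (tangent_cone C p)"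
    "\<exists>d>0. \<forall>h. norm h < d \<longrightarrow> (p + h \<in> C \<longleftrightarrow> h \<in> tangent_cone C p)"
proof -
  let ?S = "(\<lambda>a. (a, 0::real)) ` A"
  have det: "x \<in> C \<longleftrightarrow> x' \<in> C" if "x \<in> UNIV" "x' \<in> UNIV"
    and sg: "\<And>a b. (a, b) \<in> ?S \<Longrightarrow> sgn (inner a x - b) = sgn (inner a x' - b)" for x x'
  proof (rule sign_determinedD[OF assms(3)])
    have "sgn (inner a x) = sgn (inner a x')" if "a \<in> A" for a
      using sg[of a 0] that by simp
    then show "same_signs A x x'" by (simp add: same_signs_def)
  qed
  have f: "finite ?S" using assms by simp
  have V: "p \<in> interior UNIV" by simp
  note T = tangent_cone_locally_sign_determined[OF assms(1) f V det]
  show "closed (tangent_cone C p)" 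
    "\<exists>d>0. \<forall>h. norm h < d \<longrightarrow> (p + h \<in> C \<longleftrightarrow> h \<in> tangent_cone C p)" using T by blast+
  have "{a. (a, inner a p) \<in> ?S} \<subseteq> A" by auto
  then show "sign_determined A (tangent_cone C p)"
    using T(2) unfolding sign_determined_def same_signs_def by blast
qed

section \<open>Invariance of regular normals under local identification\<close>

lemma reg_normal_cone_cong_local:
  fixes x x' :: "'a::real_inner"
  assumes "d > 0" "\<And>h. norm h < d \<Longrightarrow> x + h \<in> Q \<longleftrightarrow> x' + h \<in> Q'"
  shows "reg_normal_cone Q x = reg_normal_cone Q' x'"
proof -
  have *: "reg_normal_cone Q x \<subseteq> reg_normal_cone Q' x'"
    if eq: "\<And>h. norm h < d \<Longrightarrow> x + h \<in> Q \<longleftrightarrow> x' + h \<in> Q'" for Q Q' and x x' :: 'a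
  proof
    fix v assume v: "v \<in> reg_normal_cone Q x"
    have "\<exists>r>0. \<forall>y\<in>Q'. dist y x' < r \<longrightarrow> inner v (y - x') \<le> e * norm (y - x')" if "e > 0" for e
    proof -
      obtain r where r: "r > 0" "\<And>y. y \<in> Q \<Longrightarrow> dist y x < r \<Longrightarrow> inner v (y - x) \<le> e * norm (y - x)"
        using v \<open>e > 0\<close> unfolding reg_normal_cone_def by blast
      have "inner v (y - x') \<le> e * norm (y - x')" if "y \<in> Q'" "dist y x' < min r d" for y
        using r(2)[of "x + (y - x')"] eq[of "y - x'"] that by (simp add: dist_norm)
      then show ?thesis using r(1) assms(1) by (metis min_less_iff_conj)
    qed
    moreover have "x' \<in> Q'" using v eq[of 0] assms(1) by (simp add: reg_normal_cone_def)
    ultimately show "v \<in> reg_normal_cone Q' x'" unfolding reg_normal_cone_def by blast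
  qed
  show ?thesis using *[of x Q x' Q'] *[of x' Q' x Q] assms(2) by blast
qed

lemma reg_normal_cone_translate_local:
  assumes "\<And>h. norm h < d \<Longrightarrow> y + h \<in> Q \<longleftrightarrow> h \<in> T" "norm h < d"
  shows "reg_normal_cone Q (y + h) = reg_normal_cone T h"
proof (rule reg_normal_cone_cong_local)
  show "d - norm h > 0" using assms by simp
  show "y + h + h' \<in> Q \<longleftrightarrow> h + h' \<in> T" if "norm h' < d - norm h" for h'
    using assms(1)[of "h + h'"] norm_triangle_ineq[of h h'] that by (simp add: add.assoc)
qed

text \<open>For small \<open>h\<close> the points \<open>w + h\<close> and \<open>w' + h\<close>
  again have equal signs: a functional vanishing at both points sees only \<open>h\<close>, and
  every other sign is frozen. Regular normals are thus constant on sign cells, in particular along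
  open rays.\<close>

lemma reg_normal_cone_same_signs:
  fixes w w' :: "'a::real_inner"
  assumes A: "finite A" and T: "sign_determined A T" and ss: "same_signs A w w'"
  shows "reg_normal_cone T w = reg_normal_cone T w'"
proof -
  have f: "finite ((\<lambda>a. (a, 0::real)) ` A)" using A by simp
  obtain d1 where d1: "d1 > 0" "\<forall>h. norm h < d1 \<longrightarrow> (\<forall>a\<in>A. inner a w \<noteq> 0 \<longrightarrow> sgn (inner a (w + h)) = sgn (inner a w))"
    using sgn_inner_locally_constant[OF f, of w] by (metis (no_types, lifting) diff_zero imageI)
  obtain d2 where d2: "d2 > 0" "\<forall>h. norm h < d2 \<longrightarrow> (\<forall>a\<in>A. inner a w' \<noteq> 0 \<longrightarrow> sgn (inner a (w' + h)) = sgn (inner a w'))"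
    using sgn_inner_locally_constant[OF f, of w'] by (metis (no_types, lifting) diff_zero imageI)
  show ?thesis
  proof (rule reg_normal_cone_cong_local)
    show "min d1 d2 > 0" using d1 d2 by simp
    fix h :: 'a assume "norm h < min d1 d2"
    then have h1: "\<And>a. a \<in> A \<Longrightarrow> inner a w \<noteq> 0 \<Longrightarrow> sgn (inner a (w + h)) = sgn (inner a w)"
      and h2: "\<And>a. a \<in> A \<Longrightarrow> inner a w' \<noteq> 0 \<Longrightarrow> sgn (inner a (w' + h)) = sgn (inner a w')"
      using d1(2) d2(2) by auto
    have "sgn (inner a (w + h)) = sgn (inner a (w' + h))" if "a \<in> A" for a
    proof (cases "inner a w = 0")
      case True
      then have "inner a w' = 0" using ss that unfolding same_signs_def by (metis sgn_zero_iff)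
      then show ?thesis using True by (simp add: inner_right_distrib)
    next
      case False
      then have "inner a w' \<noteq> 0" using ss that unfolding same_signs_def by (metis sgn_zero_iff)
      then show ?thesis using False h1 h2 that ss unfolding same_signs_def by metis
    qed
    then have "same_signs A (w + h) (w' + h)" by (simp add: same_signs_def)
    then show "w + h \<in> T \<longleftrightarrow> w' + h \<in> T" by (rule sign_determinedD[OF T])
  qed
qed

section \<open>Polars and polyhedrality of the normal cone\<close>

lemma reg_normal_cone_0_eq_polar:
  fixes C :: "'a::real_inner set"
  assumes "0 \<in> C" "\<And>c x. c > 0 \<Longrightarrow> x \<in> C \<Longrightarrow> c *\<^sub>R x \<in> C"
  shows "reg_normal_cone C 0 = {v. \<forall>x\<in>C. inner v x \<le> 0}"
proof
  show "{v. \<forall>x\<in>C. inner v x \<le> 0} \<subseteq> reg_normal_cone C 0"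
  proof
    fix v assume v: "v \<in> {v. \<forall>x\<in>C. inner v x \<le> 0}"
    have "inner v y \<le> e * norm y" if "e > 0" "y \<in> C" for e y
      using v that order_trans[of "inner v y" 0 "e * norm y"] by simp
    then show "v \<in> reg_normal_cone C 0" using assms(1) by (auto simp: reg_normal_cone_def intro: exI[of _ 1])
  qed
  show "reg_normal_cone C 0 \<subseteq> {v. \<forall>x\<in>C. inner v x \<le> 0}"
  proof (intro subsetI CollectI ballI)
    fix v x assume v: "v \<in> reg_normal_cone C 0" and x: "x \<in> C"
    show "inner v x \<le> 0"
    proof (rule field_le_epsilon)
      fix e :: real assume e: "e > 0"
      define e' where "e' = e / (norm x + 1)"
      have n: "norm x + 1 > 0" by (simp add: add_nonneg_pos)
      have e': "e' > 0" using e n by (simp add: e'_def)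
      obtain r where r: "r > 0" "\<And>y. y \<in> C \<Longrightarrow> dist y 0 < r \<Longrightarrow> inner v (y - 0) \<le> e' * norm (y - 0)"
        using v e' unfolding reg_normal_cone_def by blast
      \<comment> \<open>Shrinks \<open>x\<close> into the ball of radius \<open>r\<close>; the
        inequality is homogeneous, so \<open>c\<close> cancels afterwards.\<close>
      define c where "c = r / (norm x + 1)"
      have c: "c > 0" using r n by (simp add: c_def)
      have "c * norm x < c * (norm x + 1)" using c by simp
      also have "\<dots> = r" using n by (simp add: c_def)
      finally have "inner v (c *\<^sub>R x) \<le> e' * norm (c *\<^sub>R x)"
        using r(2)[of "c *\<^sub>R x"] assms(2)[OF c x] c by simp
      then have "inner v x \<le> e' * norm x" using c by (simp add: mult.left_commute)
      also have "\<dots> \<le> e' * (norm x + 1)" using e' by simp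
      also have "\<dots> = e" using n by (simp add: e'_def)
      finally show "inner v x \<le> 0 + e" by simp
    qed
  qed
qed

text \<open>Farkas' lemma, by separating a point from the finitely generated, hence closed,
  cone.\<close>

lemma polar_finite_halfspaces:
  fixes B :: "'a::euclidean_space set"
  assumes "finite B"
  shows "{v. \<forall>x. (\<forall>b\<in>B. inner b x \<le> 0) \<longrightarrow> inner v x \<le> 0} = convex_cone hull B"
proof
  show "convex_cone hull B \<subseteq> {v. \<forall>x. (\<forall>b\<in>B. inner b x \<le> 0) \<longrightarrow> inner v x \<le> 0}"
  proof (rule hull_minimal)
    show "convex_cone {v. \<forall>x. (\<forall>b\<in>B. inner b x \<le> 0) \<longrightarrow> inner v x \<le> 0}"
      by (auto simp: convex_cone_iff inner_left_distrib mult_nonneg_nonpos intro: add_nonpos_nonpos)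
  qed auto
  show "{v. \<forall>x. (\<forall>b\<in>B. inner b x \<le> 0) \<longrightarrow> inner v x \<le> 0} \<subseteq> convex_cone hull B"
  proof (rule subsetI, rule ccontr)
    fix v assume v: "v \<in> {v. \<forall>x. (\<forall>b\<in>B. inner b x \<le> 0) \<longrightarrow> inner v x \<le> 0}" and n: "v \<notin> convex_cone hull B"
    obtain a c where ac: "inner a v < c" "\<And>x. x \<in> convex_cone hull B \<Longrightarrow> inner a x > c"
      using separating_hyperplane_closed_point[OF convex_convex_cone_hull closed_convex_cone_hull[OF assms] n] by blast
    have c0: "c < 0" using ac(2)[OF convex_cone_hull_contains_0] by simp
    have "inner b (- a) \<le> 0" if b: "b \<in> B" for b
    proof (rule ccontr)
      assume "\<not> inner b (- a) \<le> 0"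
      then have neg: "inner a b < 0" by (simp add: inner_commute)
      \<comment> \<open>Scaled so that \<open>inner a (s *\<^sub>R b)\<close> equals
        \<open>c\<close> exactly, which contradicts the strict separation.\<close>
      define s where "s = c / inner a b"
      have "s \<ge> 0" using neg c0 by (simp add: s_def divide_nonpos_nonpos)
      then have "s *\<^sub>R b \<in> convex_cone hull B"
        using conicD[OF conic_convex_cone_hull, of b B s] hull_inc[OF b] by blast
      then have "inner a (s *\<^sub>R b) > c" by (rule ac(2))
      then show False using neg by (simp add: s_def)
    qed
    then have "inner v (- a) \<le> 0" using v by blast
    then show False using ac(1) c0 by (simp add: inner_commute)
  qed
qed

text \<open>Outer normals of the closure of the sign cell of \<open>h\<close>. A functional
  vanishing at \<open>h\<close> enters with both signs and so encodes an equation.\<close>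

definition sign_cell_normals :: "'a::real_inner set \<Rightarrow> 'a \<Rightarrow> 'a set" where
  "sign_cell_normals A h = {a\<in>A. inner a h \<le> 0} \<union> uminus ` {a\<in>A. inner a h \<ge> 0}"

lemma finite_sign_cell_normals: "finite A \<Longrightarrow> finite (sign_cell_normals A h)"
  by (simp add: sign_cell_normals_def)

lemma sign_cell_normals_le:
  assumes "same_signs A x h" "b \<in> sign_cell_normals A h"
  shows "inner b x \<le> 0"
proof -
  obtain a where a: "a \<in> A" "b = a \<and> inner a h \<le> 0 \<or> b = - a \<and> inner a h \<ge> 0"
    using assms(2) unfolding sign_cell_normals_def by blast
  have "sgn (inner a x) = sgn (inner a h)" using assms(1) a(1) by (simp add: same_signs_def)
  then have "inner a x \<le> 0 \<longleftrightarrow> inner a h \<le> 0" "inner a x \<ge> 0 \<longleftrightarrow> inner a h \<ge> 0"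
    by (metis sgn_le_0_iff, metis zero_le_sgn_iff)
  then show ?thesis using a(2) by auto
qed

text \<open>Adding a positive multiple of a point of the cell moves a point of the closed cell into
  the cell itself, so the closed cell is approximated from within.\<close>

lemma same_signs_closed_cell_add:
  assumes x: "\<forall>b\<in>sign_cell_normals A h. inner b x \<le> 0" and e: "e > 0"
  shows "same_signs A (x + e *\<^sub>R h) h"
  unfolding same_signs_def
proof
  fix a assume a: "a \<in> A"
  consider "inner a h > 0" | "inner a h < 0" | "inner a h = 0" by linarith
  then show "sgn (inner a (x + e *\<^sub>R h)) = sgn (inner a h)"
  proof cases
    case 1
    then have "- a \<in> sign_cell_normals A h" using a by (auto simp: sign_cell_normals_def)
    then have "inner (- a) x \<le> 0" using x by blast
    moreover have "e * inner a h > 0" using 1 e by simp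
    ultimately have "inner a (x + e *\<^sub>R h) > 0" by (simp add: inner_right_distrib)
    then show ?thesis using 1 by simp
  next
    case 2
    then have "a \<in> sign_cell_normals A h" using a by (auto simp: sign_cell_normals_def)
    then have "inner a x \<le> 0" using x by blast
    moreover have "e * inner a h < 0" using 2 e by (simp add: mult_pos_neg)
    ultimately have "inner a (x + e *\<^sub>R h) < 0" by (simp add: inner_right_distrib)
    then show ?thesis using 2 by simp
  next
    case 3
    then have "a \<in> sign_cell_normals A h" "- a \<in> sign_cell_normals A h"
      using a by (auto simp: sign_cell_normals_def)
    then have "inner a x \<le> 0" "inner (- a) x \<le> 0" using x by blast+
    then show ?thesis using 3 by (simp add: inner_right_distrib)
  qed
qed

lemma closed_cell_add_tendsto:
  "(\<lambda>n. x + (1 / real (Suc n)) *\<^sub>R h) \<longlonglongrightarrow> (x :: 'a::real_normed_vector)"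
proof -
  have "(\<lambda>n. x + (1 / real (Suc n)) *\<^sub>R h) \<longlonglongrightarrow> x + 0 *\<^sub>R h"
    using LIMSEQ_inverse_real_of_nat by (intro tendsto_intros) (simp add: inverse_eq_divide)
  then show ?thesis by simp
qed

lemma closed_cell_subset:
  assumes T: "sign_determined A T" "closed T" and h: "h \<in> T"
    and x: "\<forall>b\<in>sign_cell_normals A h. inner b x \<le> 0"
  shows "x \<in> T"
proof (rule closed_sequentially[OF T(2) _ closed_cell_add_tendsto])
  show "x + (1 / real (Suc n)) *\<^sub>R h \<in> T" for n
    using sign_determinedD[OF T(1) same_signs_closed_cell_add[OF x]] h by simp
qed

text \<open>The regular normal cone is the polar of the tangent cone \<open>C\<close>, which may be
  nonconvex but is a union of closed cells. The polar of a union is the intersection of the polars,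
  each of them finitely generated by Farkas' lemma, and only finitely many cells exist because their
  normals are taken from \<open>A\<close> and its negatives.\<close>

lemma polyhedron_reg_normal_cone:
  fixes T :: "'a::euclidean_space set"
  assumes A: "finite A" and T: "sign_determined A T" "closed T" and w: "w \<in> T"
  shows "polyhedron (reg_normal_cone T w)"
proof -
  define C where "C = tangent_cone T w"
  have C: "sign_determined A C" "closed C"
    using tangent_cone_sign_determined[OF T(2) A T(1)] by (auto simp: C_def)
  obtain d where d: "d > 0" "\<And>h. norm h < d \<Longrightarrow> w + h \<in> T \<longleftrightarrow> h \<in> C"
    using tangent_cone_sign_determined(3)[OF T(2) A T(1), of w] unfolding C_def by blast
  have C0: "0 \<in> C" using d(2)[of 0] d(1) w by simp
  let ?F = "(\<lambda>h. convex_cone hull sign_cell_normals A h) ` C"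
  have "reg_normal_cone T w = reg_normal_cone C 0"
    using reg_normal_cone_translate_local[of d w T C 0] d by simp
  also have "\<dots> = {v. \<forall>x\<in>C. inner v x \<le> 0}"
    using C0 sign_determined_scaleR_iff[OF C(1)] by (intro reg_normal_cone_0_eq_polar) auto
  also have "\<dots> = \<Inter>(insert UNIV ?F)"
  proof -
    have self: "\<forall>b\<in>sign_cell_normals A h. inner b h \<le> 0" for h
      by (auto simp: sign_cell_normals_def)
    have hull: "v \<in> convex_cone hull sign_cell_normals A h \<longleftrightarrow>
        (\<forall>x. (\<forall>b\<in>sign_cell_normals A h. inner b x \<le> 0) \<longrightarrow> inner v x \<le> 0)" for v h
      unfolding polar_finite_halfspaces[OF finite_sign_cell_normals[OF A], symmetric] by simp
    have "(\<forall>x\<in>C. inner v x \<le> 0) \<longleftrightarrow> (\<forall>h\<in>C. v \<in> convex_cone hull sign_cell_normals A h)" for v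
      unfolding hull using self closed_cell_subset[OF C] by blast
    then show ?thesis by (simp add: set_eq_iff)
  qed
  finally have eq: "reg_normal_cone T w = \<Inter>(insert UNIV ?F)" .
  have "?F \<subseteq> (\<lambda>B. convex_cone hull B) ` Pow (A \<union> uminus ` A)"
    by (auto simp: sign_cell_normals_def)
  then have "finite ?F" using A by (elim finite_subset) simp
  then show ?thesis
    unfolding eq using finite_sign_cell_normals[OF A]
    by (intro polyhedron_Inter) (auto intro!: polyhedron_convex_cone_hull)
qed

section \<open>Closed linear images of polyhedra\<close>

lemma polyhedron_as_inequalities:
  assumes "polyhedron S"
  obtains F where "finite F" "S = {x. \<forall>p\<in>F. inner (fst p) x \<le> snd p}"
proof -
  obtain F where F: "finite F" "S = \<Inter>F" "\<forall>h\<in>F. \<exists>a b. a \<noteq> 0 \<and> h = {x. inner a x \<le> b}"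
    using assms unfolding polyhedron_def by blast
  have "\<forall>h\<in>F. \<exists>p. h = {x. inner (fst p) x \<le> snd p}"
  proof
    fix h assume "h \<in> F"
    then obtain a b where "h = {x. inner a x \<le> b}" using F(3) by blast
    then have "h = {x. inner (fst (a, b)) x \<le> snd (a, b)}" by simp
    then show "\<exists>p. h = {x. inner (fst p) x \<le> snd p}" by (rule exI)
  qed
  from bchoice[OF this] obtain p where p: "\<forall>h\<in>F. h = {x. inner (fst (p h)) x \<le> snd (p h)}" ..
  show ?thesis
  proof (rule that)
    show "finite (p ` F)" using F by simp
    have "x \<in> S \<longleftrightarrow> (\<forall>q\<in>p ` F. inner (fst q) x \<le> snd q)" for x
    proof -
      have "x \<in> h \<longleftrightarrow> inner (fst (p h)) x \<le> snd (p h)" if "h \<in> F" for h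
        using bspec[OF p that] by blast
      then show ?thesis unfolding F(2) by simp
    qed
    then show "S = {x. \<forall>q\<in>p ` F. inner (fst q) x \<le> snd q}" by blast
  qed
qed

text \<open>Preimages of a convergent sequence may be unbounded, yet the limit is still attained.
  This is what allows limits to be taken with divergent multipliers and with divergent points
  \<open>s k\<close>; it fails for general closed convex cones.\<close>

lemma closed_linear_image_polyhedron:
  fixes f :: "'a::euclidean_space \<Rightarrow> 'b::euclidean_space"
  assumes f: "linear f" and S: "polyhedron S"
  shows "closed (f ` S)"
  unfolding closed_sequential_limits
proof (intro allI impI, elim conjE)
  fix c l assume c: "\<forall>n. c n \<in> f ` S" and cl: "c \<longlonglongrightarrow> l"
  obtain F where F: "finite F" and FS: "S = {x. \<forall>p\<in>F. inner (fst p) x \<le> snd p}"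
    using polyhedron_as_inequalities[OF S] .
  have contf: "continuous_on UNIV f" by (rule linear_continuous_on[OF f[unfolded linear_conv_bounded_linear]])
  have clS: "closed S" by (rule polyhedron_imp_closed[OF S])
  define M where "M n = S \<inter> f -` {c n}" for n
  have "closed (f -` {c n})" for n by (intro closed_vimage contf) simp
  then have "closed (M n)" for n unfolding M_def by (intro closed_Int clS)
  moreover have "M n \<noteq> {}" for n using spec[OF c, of n] by (auto simp: M_def)
  ultimately have "\<exists>x\<in>M n. \<forall>y\<in>M n. dist 0 x \<le> dist 0 y" for n
    using distance_attains_inf by meson
  then have "\<forall>n. \<exists>x. x \<in> M n \<and> (\<forall>y\<in>M n. norm x \<le> norm y)" by (simp add: Bex_def)
  from choice[OF this] obtain z where z: "\<forall>n. z n \<in> M n \<and> (\<forall>y\<in>M n. norm (z n) \<le> norm y)" ..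
  have zM: "z n \<in> S" "f (z n) = c n" for n using z by (auto simp: M_def)
  have min: "norm (z n) \<le> norm y" if "y \<in> S" "f y = c n" for y n using z that by (auto simp: M_def)
  show "l \<in> f ` S"
  proof (cases "bounded (range z)")
    case True
    then obtain x r where x: "strict_mono r" "(z \<circ> r) \<longlonglongrightarrow> x"
      using bounded_imp_convergent_subsequence by blast
    have "x \<in> S" by (rule closed_sequentially[OF clS _ x(2)]) (simp add: zM)
    moreover have "(\<lambda>n. f ((z \<circ> r) n)) \<longlonglongrightarrow> f x"
      by (rule continuous_on_tendsto_compose[OF contf x(2)]) auto
    then have "(c \<circ> r) \<longlonglongrightarrow> f x" by (simp add: zM comp_def)
    then have "f x = l" using LIMSEQ_unique LIMSEQ_subseq_LIMSEQ[OF cl x(1)] by blast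
    ultimately show ?thesis by blast
  next
    case False
    \<comment> \<open>A limit direction of the normalised minimal-norm preimages lies in the kernel and in the
      recession cone, so subtracting it yields preimages of smaller norm.\<close>
    have "\<exists>n. norm (z n) > real k \<and> n \<ge> k" for k
    proof (rule ccontr)
      assume "\<nexists>n. norm (z n) > real k \<and> n \<ge> k"
      then have "norm (z n) \<le> real k" if "n \<ge> k" for n using that by force
      then have "norm (z n) \<le> real k + (\<Sum>i<k. norm (z i))" for n
      proof (cases "n \<ge> k")
        case True
        then show ?thesis using \<open>\<And>n. n \<ge> k \<Longrightarrow> norm (z n) \<le> real k\<close>[of n] sum_nonneg[of "{..<k}" "\<lambda>i. norm (z i)"] by simp
      next
        case False
        then have "norm (z n) \<le> (\<Sum>i<k. norm (z i))" by (intro member_le_sum) auto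
        then show ?thesis by simp
      qed
      then show False using False by (auto simp: bounded_iff)
    qed
    then have "\<forall>k. \<exists>n. norm (z n) > real k \<and> n \<ge> k" by blast
    \<comment> \<open>The bound \<open>q k \<ge> k\<close> accompanies the growth of the norms so
      that \<open>c\<close> still tends to \<open>l\<close> along the selected indices.\<close>
    from choice[OF this] obtain q where q: "\<forall>k. norm (z (q k)) > real k \<and> q k \<ge> k" ..
    have bd: "bounded (range (\<lambda>k. sgn (z (q k))))"
      by (auto simp: bounded_iff norm_sgn intro!: exI[of _ 1])
    obtain d r where d: "strict_mono r" "((\<lambda>k. sgn (z (q k))) \<circ> r) \<longlonglongrightarrow> d"
      using bounded_imp_convergent_subsequence[OF bd] by blast
    define x where "x k = z (q (r k))" for k
    define N where "N k = norm (x k)" for k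
    have N: "N k > real (r k)" for k using q by (simp add: N_def x_def)
    have Npos: "N k > 0" for k using N[of k] by (rule le_less_trans[rotated]) simp
    have Ntop: "filterlim N at_top sequentially"
    proof (rule filterlim_at_top_mono)
      show "filterlim (\<lambda>k. real k) at_top sequentially" by (rule filterlim_real_sequentially)
      show "\<forall>\<^sub>F k in sequentially. real k \<le> N k"
        using N seq_suble[OF d(1)] by (intro always_eventually allI) (meson le_trans less_imp_le of_nat_le_iff order_trans)
    qed
    have N0: "(\<lambda>k. 1 / N k) \<longlonglongrightarrow> 0"
      using tendsto_inverse_0_at_top[OF Ntop] by (simp add: inverse_eq_divide)
    have xd: "(\<lambda>k. (1 / N k) *\<^sub>R x k) \<longlonglongrightarrow> d"
      using d(2) by (simp add: comp_def x_def N_def sgn_div_norm inverse_eq_divide)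
    have nd: "norm d = 1"
    proof -
      have "(\<lambda>k. norm ((1 / N k) *\<^sub>R x k)) \<longlonglongrightarrow> norm d" by (intro tendsto_intros xd)
      moreover have "(\<lambda>k. norm ((1 / N k) *\<^sub>R x k)) = (\<lambda>k. 1)"
      proof
        show "norm ((1 / N k) *\<^sub>R x k) = 1" for k using Npos[of k] by (simp add: N_def)
      qed
      ultimately have "(\<lambda>k::nat. 1) \<longlonglongrightarrow> norm d" by (simp only:)
      then show ?thesis by (simp only: LIMSEQ_const_iff)
    qed
    have qtop: "filterlim (\<lambda>k. q (r k)) at_top sequentially"
    proof (rule filterlim_at_top_mono[OF filterlim_ident])
      show "\<forall>\<^sub>F k in sequentially. k \<le> q (r k)"
        using q seq_suble[OF d(1)] le_trans by (intro always_eventually allI) blast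
    qed
    have "f d = 0"
    proof -
      have "(\<lambda>k. f ((1 / N k) *\<^sub>R x k)) \<longlonglongrightarrow> f d"
        by (rule continuous_on_tendsto_compose[OF contf xd]) auto
      then have "(\<lambda>k. (1 / N k) *\<^sub>R c (q (r k))) \<longlonglongrightarrow> f d"
        by (simp add: linear_scale[OF f] x_def zM)
      moreover have "(\<lambda>k. (1 / N k) *\<^sub>R c (q (r k))) \<longlonglongrightarrow> 0 *\<^sub>R l"
        by (intro tendsto_intros N0 filterlim_compose[OF cl qtop])
      ultimately have "f d = 0 *\<^sub>R l" by (rule LIMSEQ_unique)
      then show ?thesis by simp
    qed
    have "\<forall>\<^sub>F k in sequentially. inner (fst p) (x k - d) \<le> snd p" if p: "p \<in> F" for p
    proof -
      have le: "inner (fst p) (x k) \<le> snd p" for k using zM(1)[of "q (r k)"] p unfolding FS by (simp add: x_def)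
      have lim: "(\<lambda>k. (1 / N k) * inner (fst p) (x k)) \<longlonglongrightarrow> inner (fst p) d"
        using tendsto_inner[OF tendsto_const xd, of "fst p"] by simp
      have "inner (fst p) d \<le> 0"
      proof (rule LIMSEQ_le[OF lim])
        show "(\<lambda>k. (1 / N k) * snd p) \<longlonglongrightarrow> 0" using tendsto_mult[OF N0 tendsto_const, of "snd p"] by simp
        show "\<exists>n0. \<forall>k\<ge>n0. 1 / N k * inner (fst p) (x k) \<le> 1 / N k * snd p"
          using le Npos by (auto intro!: exI[of _ 0] mult_left_mono simp: less_imp_le divide_right_mono)
      qed
      \<comment> \<open>If the functional vanishes at \<open>d\<close>, subtracting \<open>d\<close>
        leaves the constraint as it is. If it is negative there, its value at \<open>x k\<close>
        tends to minus infinity at rate \<open>N k\<close> and absorbs the fixed change.\<close>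
      then consider "inner (fst p) d = 0" | "inner (fst p) d < 0" by linarith
      then show ?thesis
      proof cases
        case 1
        then show ?thesis using le by (simp add: inner_diff_right)
      next
        case 2
        have "(\<lambda>k. (1 / N k) * (inner (fst p) (x k - d) - snd p)) \<longlonglongrightarrow> inner (fst p) d - 0 * (inner (fst p) d + snd p)"
        proof -
          have eq: "(1 / N k) * (inner (fst p) (x k - d) - snd p) = (1 / N k) * inner (fst p) (x k) - (1 / N k) * (inner (fst p) d + snd p)" for k
            by (simp add: inner_diff_right algebra_simps diff_divide_distrib add_divide_distrib)
          show ?thesis unfolding eq by (intro tendsto_intros lim N0)
        qed
        then have "\<forall>\<^sub>F k in sequentially. (1 / N k) * (inner (fst p) (x k - d) - snd p) < 0"
          using 2 by (intro order_tendstoD(2)) auto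
        then show ?thesis
        proof eventually_elim
          case (elim k)
          then have "inner (fst p) (x k - d) - snd p < 0"
            using Npos[of k] by (simp add: divide_less_0_iff)
          then show ?case by simp
        qed
      qed
    qed
    then have ev1: "\<forall>\<^sub>F k in sequentially. \<forall>p\<in>F. inner (fst p) (x k - d) \<le> snd p"
      using F by (simp add: eventually_ball_finite_distrib)
    have "(\<lambda>k. inner ((1 / N k) *\<^sub>R x k) d) \<longlonglongrightarrow> inner d d" by (intro tendsto_intros xd)
    then have ev2: "\<forall>\<^sub>F k in sequentially. inner ((1 / N k) *\<^sub>R x k) d > 1/2"
      using nd by (intro order_tendstoD(1)) (auto simp: norm_eq_1)
    have ev3: "\<forall>\<^sub>F k in sequentially. N k \<ge> 2" using Ntop by (simp add: filterlim_at_top)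
    obtain k where k: "\<forall>p\<in>F. inner (fst p) (x k - d) \<le> snd p" "inner ((1 / N k) *\<^sub>R x k) d > 1/2" "N k \<ge> 2"
      using eventually_conj[OF ev1 eventually_conj[OF ev2 ev3]] by (metis (no_types, lifting) eventually_sequentially le_refl)
    \<comment> \<open>As \<open>d\<close> is a unit vector, minimality gives
      \<open>2 * inner (x k) d \<le> 1\<close>, whereas
      \<open>inner (x k) d > N k / 2 \<ge> 1\<close>.\<close>
    have "norm (x k) \<le> norm (x k - d)"
      unfolding x_def
    proof (rule min)
      show "z (q (r k)) - d \<in> S" using k(1) by (simp add: x_def FS)
      show "f (z (q (r k)) - d) = c (q (r k))" using \<open>f d = 0\<close> by (simp add: linear_diff[OF f] zM)
    qed
    then have "inner (x k) (x k) \<le> inner (x k - d) (x k - d)" by (simp add: norm_le)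
    also have "\<dots> = inner (x k) (x k) - 2 * inner (x k) d + 1"
      using nd by (simp add: inner_diff_left inner_diff_right inner_commute norm_eq_1)
    finally have "2 * inner (x k) d \<le> 1" by simp
    moreover have "inner (x k) d > 1"
      using k(2) Npos[of k] k(3) by (simp add: less_divide_eq)
    ultimately show ?thesis by simp
  qed
qed

section \<open>Differentiable maps\<close>

lemma inner_adjoint_blinfun:
  fixes G :: "'a::euclidean_space \<Rightarrow>\<^sub>L 'b::euclidean_space"
  shows "inner (adjoint (blinfun_apply G) l) h = inner l (G h)"
  using adjoint_works[OF bounded_linear.linear[OF blinfun.bounded_linear_right], of h G l]
  by (simp add: inner_commute)

lemma second_order_taylor_ray:
  fixes g :: "'a::euclidean_space \<Rightarrow> 'b::euclidean_space"
  assumes g: "\<And>x. (g has_derivative blinfun_apply (G1 x)) (at x)"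
    and G1: "(G1 has_derivative blinfun_apply H) (at xb)"
    and e: "e > 0"
  shows "\<exists>d>0. \<forall>h. norm h < d \<longrightarrow>
    norm (g (xb + h) - g xb - G1 xb h - (1/2) *\<^sub>R H h h) \<le> e * (norm h)\<^sup>2"
proof -
  obtain d where d: "d > 0" "\<And>h. norm h < d \<Longrightarrow> norm (G1 (xb + h) - G1 xb - H h) \<le> e * norm h"
  proof -
    have "\<forall>e>0. \<exists>d>0. \<forall>y. norm (y - xb) < d \<longrightarrow> norm (G1 y - G1 xb - blinfun_apply H (y - xb)) \<le> e * norm (y - xb)"
      using G1 unfolding has_derivative_at_alt by blast
    then obtain d where "d > 0" "\<forall>y. norm (y - xb) < d \<longrightarrow> norm (G1 y - G1 xb - H (y - xb)) \<le> e * norm (y - xb)"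
      using e by blast
    then show ?thesis by (intro that[of d]) (auto dest: spec[of _ "xb + _"])
  qed
  have "norm (g (xb + h) - g xb - G1 xb h - (1/2) *\<^sub>R H h h) \<le> e * (norm h)\<^sup>2" if h: "norm h < d" for h
  proof -
    \<comment> \<open>The Taylor remainder along the segment, up to the constant
      \<open>g xb\<close>. Its derivative is the first-order remainder of \<open>G1\<close> tested
      on \<open>h\<close>, so the mean value inequality yields the second factor
      \<open>norm h\<close>.\<close>
    define \<psi> where "\<psi> s = g (xb + s *\<^sub>R h) - s *\<^sub>R G1 xb h - (s\<^sup>2 / 2) *\<^sub>R H h h" for s
    have der: "(\<psi> has_derivative (\<lambda>t. t *\<^sub>R (G1 (xb + s *\<^sub>R h) h - G1 xb h - s *\<^sub>R H h h))) (at s within {0..1})" for s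
    proof -
      have a: "((\<lambda>s. xb + s *\<^sub>R h) has_derivative (\<lambda>t. t *\<^sub>R h)) (at s within {0..1})"
        by (auto intro!: derivative_eq_intros)
      have "((\<lambda>s. g (xb + s *\<^sub>R h)) has_derivative (\<lambda>t. G1 (xb + s *\<^sub>R h) (t *\<^sub>R h))) (at s within {0..1})"
        using has_derivative_compose[OF a g] .
      then show ?thesis unfolding \<psi>_def
        by (auto intro!: derivative_eq_intros simp: blinfun.scaleR_right algebra_simps)
    qed
    have "norm (\<psi> 1 - \<psi> 0) \<le> (e * (norm h)\<^sup>2) * norm (1 - 0 :: real)"
    proof (rule differentiable_bound[of "{0..1}", OF _ der])
      fix s :: real assume s: "s \<in> {0..1}"
      have "norm (s *\<^sub>R h) \<le> norm h" using s by (auto simp: mult_left_le_one_le)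
      then have "norm (s *\<^sub>R h) < d" using h by simp
      then have b: "norm (G1 (xb + s *\<^sub>R h) - G1 xb - H (s *\<^sub>R h)) \<le> e * norm h"
        using d(2)[of "s *\<^sub>R h"] \<open>norm (s *\<^sub>R h) \<le> norm h\<close> mult_left_mono[of "norm (s *\<^sub>R h)" "norm h" e] e by linarith
      have "norm (G1 (xb + s *\<^sub>R h) h - G1 xb h - s *\<^sub>R H h h) = norm ((G1 (xb + s *\<^sub>R h) - G1 xb - H (s *\<^sub>R h)) h)"
        by (simp add: blinfun.diff_left blinfun.scaleR_left blinfun.scaleR_right)
      also have "\<dots> \<le> norm (G1 (xb + s *\<^sub>R h) - G1 xb - H (s *\<^sub>R h)) * norm h" by (rule norm_blinfun)
      also have "\<dots> \<le> e * norm h * norm h" using b by (intro mult_right_mono) auto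
      finally have *: "norm (G1 (xb + s *\<^sub>R h) h - G1 xb h - s *\<^sub>R H h h) \<le> e * (norm h)\<^sup>2"
        by (simp add: power2_eq_square)
      show "onorm (\<lambda>t. t *\<^sub>R (G1 (xb + s *\<^sub>R h) h - G1 xb h - s *\<^sub>R H h h)) \<le> e * (norm h)\<^sup>2"
        using * by (intro onorm_le) (simp add: mult.commute mult_left_mono)
    qed auto
    then show ?thesis by (simp add: \<psi>_def algebra_simps)
  qed
  then show ?thesis using d(1) by blast
qed

section \<open>Normals to the graph and adjoint calculus\<close>

text \<open>The graph is the preimage of \<open>D\<close> under the submersion sending
  \<open>(x, y)\<close> to \<open>g x - y\<close>. Moving \<open>y\<close> alone tests
  \<open>l\<close> against \<open>D\<close>; moving \<open>x\<close> and \<open>y\<close> together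
  with \<open>g x - y\<close> fixed stays in the graph in both directions and forces the equation
  for \<open>xs\<close>.\<close>

lemma reg_normal_cone_gph_iff:
  fixes g :: "'a::euclidean_space \<Rightarrow> 'b::euclidean_space"
  assumes g: "(g has_derivative blinfun_apply G) (at x)"
    and \<Phi>: "\<And>x. \<Phi> x = {g x - d | d. d \<in> D}"
  shows "(xs, - l) \<in> reg_normal_cone (gph \<Phi>) (x, y) \<longleftrightarrow>
    l \<in> reg_normal_cone D (g x - y) \<and> xs = adjoint (blinfun_apply G) l"
proof -
  have mem: "(x', y') \<in> gph \<Phi> \<longleftrightarrow> g x' - y' \<in> D" for x' y'
    unfolding gph_def \<Phi> by (auto intro!: exI[of _ "g x' - y'"])
  have gd: "\<exists>d>0. \<forall>h. norm h < d \<longrightarrow> norm (g (x + h) - g x - G h) \<le> e * norm h" if "e > 0" for e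
  proof -
    have "\<forall>e>0. \<exists>d>0. \<forall>y. norm (y - x) < d \<longrightarrow> norm (g y - g x - blinfun_apply G (y - x)) \<le> e * norm (y - x)"
      using g unfolding has_derivative_at_alt by blast
    then obtain d where "d > 0" "\<forall>y. norm (y - x) < d \<longrightarrow> norm (g y - g x - G (y - x)) \<le> e * norm (y - x)"
      using \<open>e > 0\<close> by blast
    then show ?thesis by (intro exI[of _ d]) (auto dest: spec[of _ "x + _"])
  qed
  show ?thesis
  proof
    assume L: "(xs, - l) \<in> reg_normal_cone (gph \<Phi>) (x, y)"
    have in_gph: "g x - y \<in> D" using L mem by (simp add: reg_normal_cone_def)
    have Le: "\<exists>d>0. \<forall>x' y'. g x' - y' \<in> D \<longrightarrow> norm (x' - x, y' - y) < d \<longrightarrow>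
        inner xs (x' - x) - inner l (y' - y) \<le> e * norm (x' - x, y' - y)" if e: "e > 0" for e
    proof -
      obtain d where d: "d > 0" "\<And>p. p \<in> gph \<Phi> \<Longrightarrow> dist p (x, y) < d \<Longrightarrow>
          inner (xs, - l) (p - (x, y)) \<le> e * norm (p - (x, y))"
        using L e unfolding reg_normal_cone_def by blast
      have "inner xs (x' - x) - inner l (y' - y) \<le> e * norm (x' - x, y' - y)"
        if "g x' - y' \<in> D" "norm (x' - x, y' - y) < d" for x' y'
        using d(2)[of "(x', y')"] that mem by (simp add: dist_norm)
      then show ?thesis using d(1) by blast
    qed
    have "l \<in> reg_normal_cone D (g x - y)"
      unfolding reg_normal_cone_def
    proof (intro CollectI conjI in_gph allI impI)
      fix e :: real assume "e > 0"
      from Le[OF this] obtain d where d: "d > 0" "\<And>x' y'. g x' - y' \<in> D \<Longrightarrow> norm (x' - x, y' - y) < d \<Longrightarrow>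
        inner xs (x' - x) - inner l (y' - y) \<le> e * norm (x' - x, y' - y)" by blast
      have "inner l (q - (g x - y)) \<le> e * norm (q - (g x - y))" if "q \<in> D" "dist q (g x - y) < d" for q
      proof -
        have n: "norm (x - x, (g x - q) - y) = norm (q - (g x - y))"
          by (simp add: norm_Pair norm_minus_commute algebra_simps)
        show ?thesis
          using d(2)[of x "g x - q"] that unfolding n
          by (simp add: dist_norm inner_diff_right algebra_simps)
      qed
      then show "\<exists>d>0. \<forall>q\<in>D. dist q (g x - y) < d \<longrightarrow> inner l (q - (g x - y)) \<le> e * norm (q - (g x - y))"
        using d(1) by blast
    qed
    moreover have "inner xs h \<le> inner l (G h)" for h
    proof (rule field_le_epsilon)
      fix e0 :: real assume e0: "e0 > 0"
      \<comment> \<open>Collects the coefficients of all errors below; the final 1 makes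
        \<open>B\<close> positive and the step shorter than both radii. Requiring
        \<open>e \<le> 1\<close> yields the Lipschitz estimate for \<open>\<zeta>\<close>.\<close>
      define B where "B = norm h + (norm G + 1) * norm h + norm l * norm h + 1"
      have B: "B > 0" unfolding B_def by (intro add_nonneg_pos add_nonneg_nonneg) auto
      define e where "e = min 1 (e0 / B)"
      have "e \<le> e0 / B" by (simp add: e_def)
      then have eB: "e * B \<le> e0" using B by (simp only: pos_le_divide_eq)
      have e: "e > 0" "e \<le> 1" "e * B \<le> e0" using e0 B eB by (simp_all add: e_def)
      from Le[OF e(1)] obtain d where d: "d > 0" "\<And>x' y'. g x' - y' \<in> D \<Longrightarrow> norm (x' - x, y' - y) < d \<Longrightarrow>
        inner xs (x' - x) - inner l (y' - y) \<le> e * norm (x' - x, y' - y)" by blast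
      obtain d' where d': "d' > 0" "\<And>h. norm h < d' \<Longrightarrow> norm (g (x + h) - g x - G h) \<le> e * norm h"
        using gd[OF e(1)] by blast
      define s where "s = min d d' / B"
      have s: "s > 0" using d d' B by (simp add: s_def)
      have sB: "s * B = min d d'" using B by (simp add: s_def)
      \<comment> \<open>The displacement \<open>(\<eta>, \<zeta>)\<close> leaves
        \<open>g x - y\<close> unchanged, so the moved point lies in the graph.\<close>
      define \<eta> where "\<eta> = s *\<^sub>R h"
      define \<zeta> where "\<zeta> = g (x + \<eta>) - g x"
      have "norm \<eta> < d'"
      proof -
        have "norm h < B" unfolding B_def by (simp add: add_nonneg_pos add.assoc)
        then have "s * norm h < s * B" using s by simp
        then show ?thesis using s sB by (simp add: \<eta>_def)
      qed
      then have z: "norm (\<zeta> - G \<eta>) \<le> e * norm \<eta>" using d'(2) by (simp add: \<zeta>_def)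
      have nz: "norm \<zeta> \<le> (norm G + 1) * norm \<eta>"
      proof -
        have "norm \<zeta> \<le> norm (\<zeta> - G \<eta>) + norm (G \<eta>)" using norm_triangle_sub[of \<zeta> "G \<eta>"] by linarith
        also have "\<dots> \<le> e * norm \<eta> + norm G * norm \<eta>" using z norm_blinfun by (intro add_mono)
        also have "\<dots> \<le> 1 * norm \<eta> + norm G * norm \<eta>" using e by (intro add_mono mult_right_mono) auto
        finally show ?thesis by (simp add: algebra_simps)
      qed
      have np: "norm (\<eta>, \<zeta>) \<le> norm \<eta> + (norm G + 1) * norm \<eta>"
        using norm_Pair_le[of \<eta> \<zeta>] nz by linarith
      also have "\<dots> = s * (norm h + (norm G + 1) * norm h)" using s by (simp add: \<eta>_def algebra_simps)
      also have "\<dots> < s * B" using s unfolding B_def by (intro mult_strict_left_mono) (auto intro: add_nonneg_pos simp: add.assoc)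
      finally have "norm (\<eta>, \<zeta>) < d" using sB by simp
      then have "inner xs \<eta> - inner l \<zeta> \<le> e * norm (\<eta>, \<zeta>)"
        using d(2)[of "x + \<eta>" "y + \<zeta>"] in_gph by (simp add: \<zeta>_def)
      also have "\<dots> \<le> e * (norm \<eta> + (norm G + 1) * norm \<eta>)" using np e by (intro mult_left_mono) auto
      finally have 1: "inner xs \<eta> - inner l \<zeta> \<le> e * (norm \<eta> + (norm G + 1) * norm \<eta>)" .
      have "inner l (\<zeta> - G \<eta>) \<le> norm l * (e * norm \<eta>)"
        using norm_cauchy_schwarz[of l "\<zeta> - G \<eta>"] mult_left_mono[OF z, of "norm l"] by simp
      then have "inner xs \<eta> - inner l (G \<eta>) \<le> e * (norm \<eta> + (norm G + 1) * norm \<eta> + norm l * norm \<eta>)"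
        using 1 by (simp add: inner_diff_right algebra_simps)
      then have "s * (inner xs h - inner l (G h)) \<le> s * (e * (norm h + (norm G + 1) * norm h + norm l * norm h))"
        using s by (simp add: \<eta>_def blinfun.scaleR_right algebra_simps)
      then have "inner xs h - inner l (G h) \<le> e * (norm h + (norm G + 1) * norm h + norm l * norm h)"
        using s by simp
      also have "\<dots> \<le> e * B" using e by (intro mult_left_mono) (auto simp: B_def)
      finally show "inner xs h \<le> inner l (G h) + e0" using e(3) by simp
    qed
    then have "inner xs h = inner (adjoint (blinfun_apply G) l) h" for h
      using \<open>inner xs h \<le> inner l (G h)\<close> \<open>inner xs (- h) \<le> inner l (G (- h))\<close>
      unfolding inner_adjoint_blinfun by (simp add: blinfun.minus_right antisym)
    then have "xs = adjoint (blinfun_apply G) l" by (metis vector_eq_rdot)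
    ultimately show "l \<in> reg_normal_cone D (g x - y) \<and> xs = adjoint (blinfun_apply G) l" by blast
  next
    assume R: "l \<in> reg_normal_cone D (g x - y) \<and> xs = adjoint (blinfun_apply G) l"
    show "(xs, - l) \<in> reg_normal_cone (gph \<Phi>) (x, y)"
      unfolding reg_normal_cone_def
    proof (intro CollectI conjI allI impI)
      show "(x, y) \<in> gph \<Phi>" using R mem by (simp add: reg_normal_cone_def)
      fix e0 :: real assume e0: "e0 > 0"
      \<comment> \<open>Here \<open>norm l\<close> weighs the linearisation error of
        \<open>g\<close>, and \<open>norm G + 2\<close> bounds the displacement \<open>q\<close> in
        \<open>D\<close> relative to that in the graph.\<close>
      define B where "B = norm l + (norm G + 2)"
      have B: "B > 0" unfolding B_def by (simp add: add_nonneg_pos)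
      define e where "e = min 1 (e0 / B)"
      have "e \<le> e0 / B" by (simp add: e_def)
      then have eB: "e * B \<le> e0" using B by (simp only: pos_le_divide_eq)
      have e: "e > 0" "e \<le> 1" "e * B \<le> e0" using e0 B eB by (simp_all add: e_def)
      obtain d1 where d1: "d1 > 0" "\<And>h. norm h < d1 \<Longrightarrow> norm (g (x + h) - g x - G h) \<le> e * norm h"
        using gd[OF e(1)] by blast
      obtain d2 where d2: "d2 > 0" "\<And>q. q \<in> D \<Longrightarrow> dist q (g x - y) < d2 \<Longrightarrow> inner l (q - (g x - y)) \<le> e * norm (q - (g x - y))"
        using R e unfolding reg_normal_cone_def by blast
      define d where "d = min d1 (d2 / (norm G + 2))"
      have d: "d > 0" using d1 d2 by (simp add: d_def add_nonneg_pos)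
      have "inner (xs, - l) (p - (x, y)) \<le> e0 * norm (p - (x, y))" if p: "p \<in> gph \<Phi>" "dist p (x, y) < d" for p
      proof -
        obtain x' y' where p': "p = (x', y')" by fastforce
        define h k where "h = x' - x" and "k = y' - y"
        define n where "n = norm (h, k)"
        have hn: "norm h \<le> n" "norm k \<le> n"
          unfolding n_def by (auto simp: norm_Pair intro: real_le_rsqrt)
        have pn: "p - (x, y) = (h, k)" by (simp add: p' h_def k_def)
        have nd: "n < d" using p(2) by (simp add: dist_norm pn n_def)
        have G1: "norm (g x' - g x - G h) \<le> e * norm h"
          using d1(2)[of h] hn nd by (simp add: d_def h_def)
        define q where "q = (g x' - y') - (g x - y)"
        have q: "q = (g x' - g x - G h) + G h - k" by (simp add: q_def k_def)
        have "norm q \<le> norm (g x' - g x - G h) + norm (G h) + norm k"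
          unfolding q using norm_triangle_ineq4 norm_triangle_ineq by (meson add_right_mono order_trans)
        also have "\<dots> \<le> 1 * n + norm G * n + n"
        proof (intro add_mono)
          have "e * norm h \<le> 1 * n" using e hn by (intro mult_mono) auto
          then show "norm (g x' - g x - G h) \<le> 1 * n" using G1 by linarith
          show "norm (G h) \<le> norm G * n" using norm_blinfun[of G h] mult_left_mono[OF hn(1), of "norm G"] by simp
        qed (use hn in auto)
        finally have nq: "norm q \<le> (norm G + 2) * n" by (simp add: algebra_simps)
        have "(norm G + 2) * n < d2"
          using nd by (simp add: d_def less_divide_eq add_nonneg_pos mult.commute)
        then have "dist (g x' - y') (g x - y) < d2" using nq by (simp add: dist_norm q_def)
        then have "inner l q \<le> e * norm q"
          unfolding q_def using d2(2) p(1) mem by (simp add: p')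
        also have "\<dots> \<le> e * ((norm G + 2) * n)" using nq e by simp
        finally have 1: "inner l q \<le> e * ((norm G + 2) * n)" .
        have "norm (g x' - g x - G h) \<le> e * n" using G1 mult_left_mono[OF hn(1), of e] e by linarith
        then have 2: "- inner l (g x' - g x - G h) \<le> norm l * (e * n)"
          using norm_cauchy_schwarz[of "- l" "g x' - g x - G h"] mult_left_mono[of "norm (g x' - g x - G h)" "e * n" "norm l"] by simp
        have "inner (xs, - l) (p - (x, y)) = inner l q - inner l (g x' - g x - G h)"
          using R by (simp add: pn inner_adjoint_blinfun q inner_diff_right inner_add_right)
        also have "\<dots> \<le> (e * B) * n" using 1 2 by (simp add: B_def algebra_simps)
        also have "\<dots> \<le> e0 * n" using e(3) by (intro mult_right_mono) (auto simp: n_def)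
        finally show ?thesis by (simp add: pn n_def)
      qed
      then show "\<exists>d>0. \<forall>p\<in>gph \<Phi>. dist p (x, y) < d \<longrightarrow> inner (xs, - l) (p - (x, y)) \<le> e0 * norm (p - (x, y))"
        using d by blast
    qed
  qed
qed

lemma linear_adjoint_blinfun:
  fixes G :: "'a::euclidean_space \<Rightarrow>\<^sub>L 'b::euclidean_space"
  shows "linear (adjoint (blinfun_apply G))"
  by (rule adjoint_linear[OF bounded_linear.linear[OF blinfun.bounded_linear_right]])

lemma hess_apply_eq_adjoint:
  fixes H :: "'a::euclidean_space \<Rightarrow>\<^sub>L 'a \<Rightarrow>\<^sub>L 'b::euclidean_space"
  shows "hess_apply H y u = adjoint (blinfun_apply (H u)) y"
proof (rule euclidean_eqI)
  fix i :: 'a assume "i \<in> Basis"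
  then show "inner (hess_apply H y u) i = inner (adjoint (blinfun_apply (H u)) y) i"
    by (simp add: hess_apply_def inner_adjoint_blinfun inner_sum_left inner_Basis if_distrib cong: if_cong)
qed

lemma tendsto_adjoint_blinfun:
  fixes G :: "'a::euclidean_space \<Rightarrow>\<^sub>L 'b::euclidean_space"
  assumes "(Gs \<longlongrightarrow> G) F" "(ys \<longlongrightarrow> y) F"
  shows "((\<lambda>k. adjoint (blinfun_apply (Gs k)) (ys k)) \<longlongrightarrow> adjoint (blinfun_apply G) y) F"
  unfolding tendsto_componentwise_iff[of _ "adjoint (blinfun_apply G) y"] inner_adjoint_blinfun
  by (intro ballI tendsto_intros assms)

section \<open>Elementary facts on cones and difference quotients\<close>

lemma tangent_cone_mono: "Q \<subseteq> Q' \<Longrightarrow> tangent_cone Q x \<subseteq> tangent_cone Q' x"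
  unfolding tangent_cone_def by blast

lemma reg_normal_cone_scaleR:
  assumes v: "v \<in> reg_normal_cone Q x" and c: "c > 0"
  shows "c *\<^sub>R v \<in> reg_normal_cone Q x"
proof -
  have "\<exists>d>0. \<forall>y\<in>Q. dist y x < d \<longrightarrow> inner (c *\<^sub>R v) (y - x) \<le> e * norm (y - x)" if e: "e > 0" for e
  proof -
    have "e / c > 0" using e c by simp
    then obtain d where d: "d > 0" "\<forall>y\<in>Q. dist y x < d \<longrightarrow> inner v (y - x) \<le> e / c * norm (y - x)"
      using v unfolding reg_normal_cone_def by blast
    have "inner (c *\<^sub>R v) (y - x) \<le> e * norm (y - x)" if "y \<in> Q" "dist y x < d" for y
    proof -
      have "inner v (y - x) \<le> e / c * norm (y - x)" using d(2) that by blast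
      then show ?thesis using c by (simp add: pos_le_divide_eq mult.commute)
    qed
    then show ?thesis using d(1) by blast
  qed
  then show ?thesis using v unfolding reg_normal_cone_def by blast
qed

lemma reg_normal_cone_subset_lim: "reg_normal_cone Q x \<subseteq> lim_normal_cone Q x"
proof
  fix v assume v: "v \<in> reg_normal_cone Q x"
  then have "x \<in> Q" by (simp add: reg_normal_cone_def)
  then show "v \<in> lim_normal_cone Q x"
    unfolding lim_normal_cone_def using v
    by (intro CollectI conjI exI[of _ "\<lambda>_. x"] exI[of _ "\<lambda>_. v"]) simp_all
qed

lemma reg_normal_cone_orthogonal:
  assumes T: "\<And>c x. c > 0 \<Longrightarrow> x \<in> T \<Longrightarrow> c *\<^sub>R x \<in> T" and v: "v \<in> reg_normal_cone T w"
  shows "inner v w = 0"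
proof (rule ccontr)
  assume n: "inner v w \<noteq> 0"
  then have w0: "norm w > 0" by auto
  define e where "e = \<bar>inner v w\<bar> / (2 * norm w)"
  have e: "e > 0" using n w0 by (simp add: e_def)
  have wT: "w \<in> T" using v by (simp add: reg_normal_cone_def)
  obtain d where d: "d > 0" "\<And>y. y \<in> T \<Longrightarrow> dist y w < d \<Longrightarrow> inner v (y - w) \<le> e * norm (y - w)"
    using v e unfolding reg_normal_cone_def by blast
  define s where "s = min (1/2) (d / (2 * norm w))"
  have s: "s > 0" "s \<le> 1/2" using d w0 by (auto simp: s_def)
  have "s \<le> d / (2 * norm w)" by (simp add: s_def)
  then have "s * (2 * norm w) \<le> d" using w0 by (simp add: pos_le_divide_eq)
  then have sd: "s * norm w < d" using d(1) by simp
  \<comment> \<open>The sign makes \<open>inner v (\<sigma> *\<^sub>R w)\<close> equal to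
    \<open>s\<close> times the absolute value, \<open>s \<le> 1/2\<close> keeps the factor
    \<open>1 + \<sigma>\<close> positive, and the 2 in \<open>e\<close> leaves only half of that
    value on the right.\<close>
  define \<sigma> where "\<sigma> = sgn (inner v w) * s"
  have abs: "\<bar>\<sigma>\<bar> = s" using s n by (simp add: \<sigma>_def abs_mult abs_sgn_eq)
  have "1 + \<sigma> > 0" using abs s by linarith
  then have "(1 + \<sigma>) *\<^sub>R w \<in> T" using T wT by blast
  then have "w + \<sigma> *\<^sub>R w \<in> T" by (simp add: scaleR_add_left)
  then have "inner v (\<sigma> *\<^sub>R w) \<le> e * norm (\<sigma> *\<^sub>R w)"
    using d(2)[of "w + \<sigma> *\<^sub>R w"] sd abs by (simp add: dist_norm)
  moreover have "inner v (\<sigma> *\<^sub>R w) = s * \<bar>inner v w\<bar>" by (simp add: \<sigma>_def abs_sgn mult_ac)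
  moreover have "norm (\<sigma> *\<^sub>R w) = s * norm w" by (simp add: abs)
  ultimately have "s * \<bar>inner v w\<bar> \<le> e * (s * norm w)" by (simp only:)
  also have "\<dots> = s * \<bar>inner v w\<bar> / 2" using w0 by (simp add: e_def)
  finally show False using s n by simp
qed

lemma polyhedron_Collect_inequalities:
  assumes "finite F"
  shows "polyhedron {x :: 'a::euclidean_space. \<forall>p\<in>F. inner (fst p) x \<le> snd p}"
proof -
  have "{x. \<forall>p\<in>F. inner (fst p) x \<le> snd p} = \<Inter>((\<lambda>p. {x. inner (fst p) x \<le> snd p}) ` F)" by blast
  moreover have "polyhedron \<dots>"
    using assms by (intro polyhedron_Inter) (auto simp: polyhedron_halfspace_le)
  ultimately show ?thesis by (simp only:)
qed

lemma difference_quotient_tendsto: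
  fixes f :: "'a::real_normed_vector \<Rightarrow> 'b::real_normed_vector"
  assumes f: "(f has_derivative F) (at x)"
    and t: "\<And>k. t k > 0" "t \<longlonglongrightarrow> 0"
    and u: "(\<lambda>k. (1 / t k) *\<^sub>R (xk k - x)) \<longlonglongrightarrow> u"
  shows "(\<lambda>k. (1 / t k) *\<^sub>R (f (xk k) - f x)) \<longlonglongrightarrow> F u"
proof -
  interpret F: bounded_linear F using f by (rule has_derivative_bounded_linear)
  define q where "q k = (1 / t k) *\<^sub>R (xk k - x)" for k
  have xq: "xk k = x + t k *\<^sub>R q k" for k using t(1)[of k] by (simp add: q_def)
  have qu: "q \<longlonglongrightarrow> u" using u by (simp add: q_def[abs_def])
  have "(\<lambda>k. (1 / t k) *\<^sub>R (f (xk k) - f x - F (xk k - x))) \<longlonglongrightarrow> 0"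
    unfolding tendsto_iff dist_norm
  proof (intro allI impI)
    fix e :: real assume e: "e > 0"
    define e' where "e' = e / (norm u + 1)"
    have n: "norm u + 1 > 0" by (simp add: add_nonneg_pos)
    have e': "e' > 0" using e n by (simp add: e'_def)
    obtain d where d: "d > 0" "\<And>y. norm (y - x) < d \<Longrightarrow> norm (f y - f x - F (y - x)) \<le> e' * norm (y - x)"
      using f e' unfolding has_derivative_at_alt by blast
    have "(\<lambda>k. norm (t k *\<^sub>R q k)) \<longlonglongrightarrow> norm (0 *\<^sub>R u)" by (intro tendsto_intros t qu)
    then have "\<forall>\<^sub>F k in sequentially. norm (t k *\<^sub>R q k) < d"
      using d by (intro order_tendstoD(2)) auto
    moreover have "\<forall>\<^sub>F k in sequentially. norm (q k) < norm u + 1"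
      by (intro order_tendstoD(2)[OF tendsto_norm[OF qu]]) simp
    ultimately show "\<forall>\<^sub>F k in sequentially. norm ((1 / t k) *\<^sub>R (f (xk k) - f x - F (xk k - x)) - 0) < e"
    proof eventually_elim
      case (elim k)
      have "norm (f (xk k) - f x - F (xk k - x)) \<le> e' * (t k * norm (q k))"
        using d(2)[of "xk k"] elim(1) t(1)[of k] by (simp add: xq)
      then have "norm ((1 / t k) *\<^sub>R (f (xk k) - f x - F (xk k - x))) \<le> e' * norm (q k)"
        using t(1)[of k] by (simp add: pos_divide_le_eq mult_ac)
      also have "\<dots> < e' * (norm u + 1)" using elim(2) e' by simp
      also have "\<dots> = e" using n by (simp add: e'_def)
      finally show ?case by simp
    qed
  qed
  moreover have "(\<lambda>k. F ((1 / t k) *\<^sub>R (xk k - x))) \<longlonglongrightarrow> F u" by (intro F.tendsto u)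
  ultimately have "(\<lambda>k. (1 / t k) *\<^sub>R (f (xk k) - f x - F (xk k - x)) + F ((1 / t k) *\<^sub>R (xk k - x))) \<longlonglongrightarrow> 0 + F u"
    by (rule tendsto_add)
  moreover have "(1 / t k) *\<^sub>R (f (xk k) - f x - F (xk k - x)) + F ((1 / t k) *\<^sub>R (xk k - x))
      = (1 / t k) *\<^sub>R (f (xk k) - f x)" for k
    unfolding F.scaleR unfolding scaleR_diff_right by simp
  ultimately show ?thesis by simp
qed

text \<open>The linear term is kept at \<open>xk k - x\<close> and not replaced by
  \<open>t k *\<^sub>R u\<close>: their difference divided by the square of \<open>t k\<close> may
  diverge.\<close>

lemma second_order_difference_quotient_tendsto:
  fixes g :: "'a::euclidean_space \<Rightarrow> 'b::euclidean_space"
  assumes g: "\<And>x. (g has_derivative blinfun_apply (G1 x)) (at x)"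
    and G1: "(G1 has_derivative blinfun_apply H) (at x)"
    and t: "\<And>k. t k > 0" "t \<longlonglongrightarrow> 0"
    and u: "(\<lambda>k. (1 / t k) *\<^sub>R (xk k - x)) \<longlonglongrightarrow> u"
  shows "(\<lambda>k. (1 / (t k)\<^sup>2) *\<^sub>R (g (xk k) - g x - G1 x (xk k - x))) \<longlonglongrightarrow> (1/2) *\<^sub>R H u u"
proof -
  define q where "q k = (1 / t k) *\<^sub>R (xk k - x)" for k
  have xq: "xk k = x + t k *\<^sub>R q k" for k using t(1)[of k] by (simp add: q_def)
  have qu: "q \<longlonglongrightarrow> u" using u by (simp add: q_def[abs_def])
  let ?R = "\<lambda>k. g (xk k) - g x - G1 x (xk k - x) - (1/2) *\<^sub>R H (xk k - x) (xk k - x)"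
  have "(\<lambda>k. (1 / (t k)\<^sup>2) *\<^sub>R ?R k) \<longlonglongrightarrow> 0"
    unfolding tendsto_iff dist_norm
  proof (intro allI impI)
    fix e :: real assume e: "e > 0"
    define e' where "e' = e / (norm u + 1)\<^sup>2"
    have n: "norm u + 1 > 0" by (simp add: add_nonneg_pos)
    have e': "e' > 0" using e n by (simp add: e'_def)
    obtain d where d: "d > 0" "\<And>h. norm h < d \<Longrightarrow> norm (g (x + h) - g x - G1 x h - (1/2) *\<^sub>R H h h) \<le> e' * (norm h)\<^sup>2"
      using second_order_taylor_ray[OF g G1 e'] by blast
    have "(\<lambda>k. norm (t k *\<^sub>R q k)) \<longlonglongrightarrow> norm (0 *\<^sub>R u)" by (intro tendsto_intros t qu)
    then have "\<forall>\<^sub>F k in sequentially. norm (t k *\<^sub>R q k) < d"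
      using d by (intro order_tendstoD(2)) auto
    moreover have "\<forall>\<^sub>F k in sequentially. norm (q k) < norm u + 1"
      by (intro order_tendstoD(2)[OF tendsto_norm[OF qu]]) simp
    ultimately show "\<forall>\<^sub>F k in sequentially. norm ((1 / (t k)\<^sup>2) *\<^sub>R ?R k - 0) < e"
    proof eventually_elim
      case (elim k)
      have "norm (?R k) \<le> e' * (norm (t k *\<^sub>R q k))\<^sup>2"
        using d(2)[of "t k *\<^sub>R q k"] elim(1) unfolding xq by simp
      then have "norm (?R k) \<le> e' * (norm (q k))\<^sup>2 * (t k)\<^sup>2"
        using t(1)[of k] by (simp add: power_mult_distrib mult_ac)
      then have "norm ((1 / (t k)\<^sup>2) *\<^sub>R ?R k) \<le> e' * (norm (q k))\<^sup>2"
        using t(1)[of k] by (simp add: pos_divide_le_eq)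
      also have "\<dots> < e' * (norm u + 1)\<^sup>2" using elim(2) e' by (simp add: power_strict_mono)
      also have "\<dots> = e" using n by (simp add: e'_def)
      finally show ?case by simp
    qed
  qed
  moreover have "(\<lambda>k. (1/2) *\<^sub>R H (q k) (q k)) \<longlonglongrightarrow> (1/2) *\<^sub>R H u u"
    by (intro tendsto_intros qu)
  ultimately have "(\<lambda>k. (1 / (t k)\<^sup>2) *\<^sub>R ?R k + (1/2) *\<^sub>R H (q k) (q k)) \<longlonglongrightarrow> 0 + (1/2) *\<^sub>R H u u"
    by (rule tendsto_add)
  moreover have "(1 / (t k)\<^sup>2) *\<^sub>R ?R k + (1/2) *\<^sub>R H (q k) (q k)
      = (1 / (t k)\<^sup>2) *\<^sub>R (g (xk k) - g x - G1 x (xk k - x))" for k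
  proof -
    have "H (xk k - x) (xk k - x) = (t k)\<^sup>2 *\<^sub>R H (q k) (q k)"
      by (simp add: xq blinfun.scaleR_left blinfun.scaleR_right power2_eq_square)
    then show ?thesis using t(1)[of k] by (simp add: scaleR_diff_right)
  qed
  ultimately show ?thesis by simp
qed

section \<open>Limits along divergent multipliers and points\<close>

text \<open>Although \<open>l k\<close> may diverge, its image under the adjoint of \<open>G\<close>
  converges, because the difference from the adjoint of \<open>Gs k\<close> is a convergent quotient
  applied to \<open>t k *\<^sub>R l k\<close>. The limit is an image of a tangent direction of
  \<open>K\<close> at \<open>m\<close>, since the image of that polyhedral tangent cone is
  closed.\<close>

lemma scaled_multiplier_limit:
  fixes G Hu :: "'a::euclidean_space \<Rightarrow>\<^sub>L 'b::euclidean_space"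
  assumes K: "polyhedron K"
    and t: "\<And>k. t k > 0" "t \<longlonglongrightarrow> 0"
    and lK: "\<And>k. t k *\<^sub>R l k \<in> K"
    and l: "(\<lambda>k. t k *\<^sub>R l k) \<longlonglongrightarrow> m"
    and Gs: "(\<lambda>k. (1 / t k) *\<^sub>R (Gs k - G)) \<longlonglongrightarrow> Hu"
    and x: "(\<lambda>k. adjoint (blinfun_apply (Gs k)) (l k)) \<longlonglongrightarrow> x"
  shows "m \<in> K" and "adjoint (blinfun_apply G) m = 0"
    and "\<exists>z\<in>tangent_cone K m. x = adjoint (blinfun_apply Hu) m + adjoint (blinfun_apply G) z"
proof -
  let ?A = "\<lambda>G. adjoint (blinfun_apply G)"
  have lin: "linear (?A G)" by (rule linear_adjoint_blinfun)
  show mK: "m \<in> K" using closed_sequentially[OF polyhedron_imp_closed[OF K] lK l] .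
  have split: "?A G (l k) = ?A (Gs k) (l k) - ?A ((1 / t k) *\<^sub>R (Gs k - G)) (t k *\<^sub>R l k)" for k
  proof (rule euclidean_eqI)
    fix i :: 'a
    show "inner (?A G (l k)) i = inner (?A (Gs k) (l k) - ?A ((1 / t k) *\<^sub>R (Gs k - G)) (t k *\<^sub>R l k)) i"
      using t(1)[of k]
      by (simp add: inner_diff_left inner_adjoint_blinfun blinfun.scaleR_left blinfun.diff_left inner_diff_right diff_divide_distrib)
  qed
  have L: "(\<lambda>k. ?A G (l k)) \<longlonglongrightarrow> x - ?A Hu m"
    unfolding split by (intro tendsto_diff x tendsto_adjoint_blinfun Gs l)
  have "(\<lambda>k. t k *\<^sub>R ?A G (l k)) \<longlonglongrightarrow> 0 *\<^sub>R (x - ?A Hu m)" by (intro tendsto_scaleR t L)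
  moreover have "(\<lambda>k. t k *\<^sub>R ?A G (l k)) \<longlonglongrightarrow> ?A G m"
    unfolding linear_scale[OF lin, symmetric] by (intro tendsto_adjoint_blinfun l tendsto_const)
  ultimately have "0 *\<^sub>R (x - ?A Hu m) = ?A G m" by (rule LIMSEQ_unique)
  then show Gm: "?A G m = 0" by simp
  obtain F where F: "finite F" and FK: "K = {x. \<forall>p\<in>F. inner (fst p) x \<le> snd p}"
    using polyhedron_as_inequalities[OF K] .
  \<comment> \<open>The constraints active at \<open>m\<close>, made homogeneous; \<open>R\<close>
    is the cone of feasible directions of \<open>K\<close> at \<open>m\<close>.\<close>
  define F0 where "F0 = (\<lambda>p. (fst p, 0 :: real)) ` {p\<in>F. inner (fst p) m = snd p}"
  define R where "R = {z. \<forall>p\<in>F0. inner (fst p) z \<le> snd p}"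
  have "polyhedron R" unfolding R_def F0_def using F by (intro polyhedron_Collect_inequalities) simp
  then have "closed (?A G ` R)" by (rule closed_linear_image_polyhedron[OF lin])
  moreover have "?A G (l k) \<in> ?A G ` R" for k
  proof
    \<comment> \<open>As \<open>m\<close> lies in the kernel, the divergent part
      \<open>m / t k\<close> can be removed without changing the image, and what remains lies in
      \<open>R\<close>.\<close>
    show "?A G (l k) = ?A G (l k - (1 / t k) *\<^sub>R m)"
      by (simp add: linear_diff[OF lin] linear_scale[OF lin] Gm)
    show "l k - (1 / t k) *\<^sub>R m \<in> R"
      unfolding R_def
    proof (intro CollectI ballI)
      fix p assume "p \<in> F0"
      then obtain q where q: "q \<in> F" "p = (fst q, 0)" "inner (fst q) m = snd q" by (auto simp: F0_def)
      have "t k * inner (fst q) (l k) \<le> inner (fst q) m" using lK[of k] q unfolding FK by simp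
      then show "inner (fst p) (l k - (1 / t k) *\<^sub>R m) \<le> snd p"
        using t(1)[of k] q(2) by (simp add: inner_diff_right pos_le_divide_eq mult.commute)
    qed
  qed
  ultimately have "x - ?A Hu m \<in> ?A G ` R" using L by (rule closed_sequentially)
  then obtain z where z: "z \<in> R" "x - ?A Hu m = ?A G z" by blast
  have "\<forall>\<^sub>F s in at_right 0. inner (fst p) (m + s *\<^sub>R z) \<le> snd p" if p: "p \<in> F" for p
  proof (cases "inner (fst p) m = snd p")
    case True
    then have "inner (fst p) z \<le> 0" using z(1) p unfolding R_def F0_def by force
    then have "inner (fst p) (m + s *\<^sub>R z) \<le> snd p" if "s > 0" for s
      using that True by (simp add: inner_add_right mult_nonneg_nonpos)
    then show ?thesis by (auto simp: eventually_at_right_field intro: exI[of _ 1])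
  next
    case False
    then have "inner (fst p) m < snd p" using mK p unfolding FK by force
    moreover have "((\<lambda>s. inner (fst p) (m + s *\<^sub>R z)) \<longlongrightarrow> inner (fst p) (m + 0 *\<^sub>R z)) (at_right 0)"
      by (intro tendsto_intros)
    ultimately have "\<forall>\<^sub>F s in at_right 0. inner (fst p) (m + s *\<^sub>R z) < snd p"
      by (intro order_tendstoD(2)) auto
    then show ?thesis by eventually_elim simp
  qed
  then have "\<forall>\<^sub>F s in at_right 0. m + s *\<^sub>R z \<in> K"
    using F by (simp add: FK eventually_ball_finite_distrib)
  then obtain b where b: "b > 0" "\<And>s. 0 < s \<Longrightarrow> s < b \<Longrightarrow> m + s *\<^sub>R z \<in> K"
    by (auto simp: eventually_at_right_field)
  have "z \<in> tangent_cone K m"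
    unfolding tangent_cone_def
  proof (intro CollectI exI conjI)
    let ?t = "\<lambda>n. (b / 2) * (1 / real (Suc n))"
    show "\<forall>k. ?t k > 0" using b by simp
    have "(\<lambda>n. (b / 2) * (1 / real (Suc n))) \<longlonglongrightarrow> (b / 2) * 0"
      using LIMSEQ_inverse_real_of_nat by (intro tendsto_intros) (simp add: inverse_eq_divide)
    then show "?t \<longlonglongrightarrow> 0" by simp
    show "(\<lambda>k::nat. z) \<longlonglongrightarrow> z" by simp
    show "\<forall>k. m + ?t k *\<^sub>R z \<in> K"
    proof
      fix k
      have "b / 2 * (1 / real (Suc k)) \<le> b / 2 * 1" using b by (intro mult_left_mono) auto
      also have "\<dots> < b" using b by simp
      finally show "m + ?t k *\<^sub>R z \<in> K" using b by (intro b(2)) auto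
    qed
  qed
  moreover have "x = ?A Hu m + ?A G z" using z(2) by (simp add: algebra_simps)
  ultimately show "\<exists>z\<in>tangent_cone K m. x = ?A Hu m + ?A G z" by blast
qed

text \<open>The points \<open>s k\<close> need not converge, but \<open>b k\<close> lies in the
  image of the polyhedron of all \<open>(s, w)\<close> with \<open>w\<close> in the closed cell
  under \<open>w - G s\<close>, and that image is closed. The resulting \<open>w\<close> is
  approached from within the cell, where the normals are those at \<open>w0\<close>; these become
  limiting normals at \<open>w\<close>.\<close>

lemma sign_cell_limit_normal_cone:
  fixes G :: "'a::euclidean_space \<Rightarrow> 'b::euclidean_space"
  assumes A: "finite A" and T: "sign_determined A T" "closed T" and G: "linear G"
    and w0: "w0 \<in> T" and W: "\<And>k. same_signs A (G (s k) + b k) w0" and b: "b \<longlonglongrightarrow> b0"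
  shows "\<exists>s. reg_normal_cone T w0 \<subseteq> lim_normal_cone T (G s + b0)"
proof -
  let ?B = "sign_cell_normals A w0"
  \<comment> \<open>The zero first component leaves \<open>s\<close> unconstrained.\<close>
  define F where "F = (\<lambda>a. ((0 :: 'a, a), 0 :: real)) ` ?B"
  define P where "P = {x. \<forall>p\<in>F. inner (fst p) x \<le> snd p}"
  define f where "f = (\<lambda>(s, w). w - G s)"
  have "polyhedron P" unfolding P_def F_def using finite_sign_cell_normals[OF A]
    by (intro polyhedron_Collect_inequalities) simp
  moreover have "linear f"
    unfolding f_def by (rule linearI) (auto simp: linear_add[OF G] linear_scale[OF G] scaleR_diff_right)
  ultimately have "closed (f ` P)" by (intro closed_linear_image_polyhedron)
  moreover have "b k \<in> f ` P" for k
  proof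
    show "b k = f (s k, G (s k) + b k)" by (simp add: f_def)
    show "(s k, G (s k) + b k) \<in> P"
      unfolding P_def F_def using sign_cell_normals_le[OF W] by (auto simp: inner_add_right)
  qed
  ultimately have "b0 \<in> f ` P" using b by (rule closed_sequentially)
  then obtain s w where sw: "(s, w) \<in> P" "b0 = w - G s" by (auto simp: f_def)
  have w: "\<forall>a\<in>?B. inner a w \<le> 0" using sw(1) by (auto simp: P_def F_def)
  have "reg_normal_cone T w0 \<subseteq> lim_normal_cone T w"
  proof
    fix v assume v: "v \<in> reg_normal_cone T w0"
    have ss: "same_signs A (w + (1 / real (Suc n)) *\<^sub>R w0) w0" for n
      by (rule same_signs_closed_cell_add[OF w]) simp
    have "\<forall>n. w + (1 / real (Suc n)) *\<^sub>R w0 \<in> T"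
      using sign_determinedD[OF T(1) ss] w0 by blast
    moreover have "\<forall>n. v \<in> reg_normal_cone T (w + (1 / real (Suc n)) *\<^sub>R w0)"
      using reg_normal_cone_same_signs[OF A T(1) ss] v by blast
    ultimately show "v \<in> lim_normal_cone T w"
      unfolding lim_normal_cone_def
      using closed_cell_subset[OF T w0 w] closed_cell_add_tendsto[of w w0]
      by (intro CollectI conjI exI[of _ "\<lambda>n. w + (1 / real (Suc n)) *\<^sub>R w0"] exI[of _ "\<lambda>_. v"]) simp_all
  qed
  moreover have "G s + b0 = w" using sw(2) by simp
  ultimately show ?thesis by metis
qed

text \<open>Pigeonhole on the finitely many sign patterns; the sequence may be unbounded.\<close>

lemma same_signs_subsequence:
  fixes W :: "nat \<Rightarrow> 'a::real_inner"
  assumes A: "finite A"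
  obtains r :: "nat \<Rightarrow> nat" and w where "strict_mono r" "\<forall>k. same_signs A (W (r k)) w"
proof -
  define pat where "pat k = ({a\<in>A. inner a (W k) > 0}, {a\<in>A. inner a (W k) < 0})" for k
  have "range pat \<subseteq> Pow A \<times> Pow A" by (auto simp: pat_def)
  then have "finite (range pat)" using A by (meson finite_Pow_iff finite_SigmaI finite_subset)
  then obtain k0 where "infinite {k \<in> UNIV. pat k = pat k0}"
    using pigeonhole_infinite[of "UNIV :: nat set" pat] by auto
  then obtain r :: "nat \<Rightarrow> nat" where r: "strict_mono r" "\<And>n. r n \<in> {k \<in> UNIV. pat k = pat k0}"
    using infinite_enumerate by blast
  have "same_signs A (W (r n)) (W k0)" for n
  proof -
    have "pat (r n) = pat k0" using r(2) by blast
    then have p: "{a\<in>A. inner a (W (r n)) > 0} = {a\<in>A. inner a (W k0) > 0}"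
      "{a\<in>A. inner a (W (r n)) < 0} = {a\<in>A. inner a (W k0) < 0}" by (simp_all add: pat_def)
    have "sgn (inner a (W (r n))) = sgn (inner a (W k0))" if "a \<in> A" for a
    proof -
      have "inner a (W (r n)) > 0 \<longleftrightarrow> inner a (W k0) > 0" "inner a (W (r n)) < 0 \<longleftrightarrow> inner a (W k0) < 0"
        using p that by blast+
      then show ?thesis by (auto simp: sgn_if)
    qed
    then show ?thesis by (simp add: same_signs_def)
  qed
  then have "\<forall>n. same_signs A (W (r n)) (W k0)" ..
  then show ?thesis by (rule that[OF r(1)])
qed

section \<open>The second-order multiplier system\<close>

text \<open>The common core of the qualification condition (\<open>xs = 0\<close> and
  \<open>v = 0\<close>) and of (S''), without the sign condition on \<open>v\<close>.\<close>

definition multiplier_system ::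
  "('a::euclidean_space \<Rightarrow>\<^sub>L 'b::euclidean_space) \<Rightarrow> ('a \<Rightarrow>\<^sub>L 'a \<Rightarrow>\<^sub>L 'b) \<Rightarrow> 'a \<Rightarrow> 'b set \<Rightarrow> 'b \<Rightarrow> 'a \<Rightarrow> 'b \<Rightarrow> 'b \<Rightarrow> bool" where
  "multiplier_system G H u T w xs ys zs \<longleftrightarrow>
     xs = hess_apply H ys u + adjoint (blinfun_apply G) zs \<and> ys \<in> lim_normal_cone T w
   \<and> adjoint (blinfun_apply G) ys = 0 \<and> zs \<in> tangent_cone (lim_normal_cone T w) ys"

text \<open>The limit argument works inside one polyhedral piece \<open>K\<close> of the limiting
  normal cone; monotonicity of tangent cones carries its result over.\<close>

lemma multiplier_systemI:
  fixes H :: "'a::euclidean_space \<Rightarrow>\<^sub>L 'a \<Rightarrow>\<^sub>L 'b::euclidean_space"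
  assumes "K \<subseteq> lim_normal_cone T w" "m \<in> K" "adjoint (blinfun_apply G) m = 0"
    and "z \<in> tangent_cone K m" "x = adjoint (blinfun_apply (H u)) m + adjoint (blinfun_apply G) z"
  shows "multiplier_system G H u T w x m z"
  unfolding multiplier_system_def hess_apply_eq_adjoint
  using assms tangent_cone_mono[OF assms(1)] by blast

lemma asym_seq_data_multiplier_system:
  fixes g :: "'a::euclidean_space \<Rightarrow> 'b::euclidean_space"
    and G1 :: "'a \<Rightarrow> ('a \<Rightarrow>\<^sub>L 'b)" and G2 :: "'a \<Rightarrow> ('a \<Rightarrow>\<^sub>L 'a \<Rightarrow>\<^sub>L 'b)"
    and xb u :: 'a and D :: "'b set"
  defines "L \<equiv> blinfun_apply (G1 xb)"
  defines "T \<equiv> tangent_cone (tangent_cone D (g xb)) (L u)"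
    and "b0 \<equiv> (1/2) *\<^sub>R G2 xb u u"
  assumes g_deriv: "\<And>x. (g has_derivative blinfun_apply (G1 x)) (at x)"
    and G1_deriv: "(G1 has_derivative blinfun_apply (G2 xb)) (at xb)"
    and D_closed: "closed D"
    and D_poly: "polyhedral_near D (g xb)"
    and Phi_def: "\<And>x. \<Phi> x = {g x - d | d. d \<in> D}"
    and in_gph: "(xb, 0) \<in> gph \<Phi>"
    and qual: "\<forall>s ys zs. multiplier_system (G1 xb) (G2 xb) u T (L s + b0) 0 ys zs \<longrightarrow> ys = 0"
    and data: "asym_seq_data \<Phi> xb 0 u xk yk xsk lk xst yst"
  shows "\<exists>s ys zs v. inner ys v \<ge> 0
      \<and> multiplier_system (G1 xb) (G2 xb) u T (L s + b0 - v) xst ys zs"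
proof -
  define C where "C = tangent_cone D (g xb)"
  define p where "p = L u"
  have T_eq: "T = tangent_cone C p" by (simp add: T_def C_def p_def)
  interpret L: bounded_linear L unfolding L_def by (rule blinfun.bounded_linear_right)
  have adjL: "adjoint L = adjoint (blinfun_apply (G1 xb))" by (simp add: L_def)
  have inner_adj: "inner (adjoint L m) h = inner m (L h)" for m h
    by (simp add: L_def inner_adjoint_blinfun)
  obtain A where A: "finite A" and CA: "sign_determined A C" "closed C"
    and locD: "\<exists>d>0. \<forall>h. norm h < d \<longrightarrow> (g xb + h \<in> D \<longleftrightarrow> h \<in> C)"
    using tangent_cone_polyhedral_near[OF D_closed D_poly] unfolding C_def by blast
  have TA: "sign_determined A T" "closed T"
    and locC: "\<exists>d>0. \<forall>h. norm h < d \<longrightarrow> (p + h \<in> C \<longleftrightarrow> h \<in> T)"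
    using tangent_cone_sign_determined[OF CA(2) A CA(1), of p] unfolding T_eq by blast+
  obtain dD where dD: "dD > 0" "\<And>h. norm h < dD \<Longrightarrow> g xb + h \<in> D \<longleftrightarrow> h \<in> C" using locD by blast
  obtain dC where dC: "dC > 0" "\<And>h. norm h < dC \<Longrightarrow> p + h \<in> C \<longleftrightarrow> h \<in> T" using locC by blast

  have d: "\<And>k. 0 \<notin> \<Phi> (xk k)" "\<And>k. yk k \<noteq> 0" "\<And>k. xsk k \<in> reg_coderiv \<Phi> (xk k) (yk k) (lk k)"
    "xk \<longlonglongrightarrow> xb" "xsk \<longlonglongrightarrow> xst"
    "(\<lambda>k. (1 / norm (xk k - xb)) *\<^sub>R (xk k - xb)) \<longlonglongrightarrow> u"
    "(\<lambda>k. (1 / norm (xk k - xb)) *\<^sub>R yk k) \<longlonglongrightarrow> 0"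
    "filterlim (\<lambda>k. norm (lk k)) at_top sequentially"
    "(\<lambda>k. (1 / norm (yk k)) *\<^sub>R yk k - (1 / norm (lk k)) *\<^sub>R lk k) \<longlonglongrightarrow> 0"
    "(\<lambda>k. (norm (yk k) / norm (xk k - xb)) *\<^sub>R lk k) \<longlonglongrightarrow> yst"
    using data unfolding asym_seq_data_def by simp_all
  define t where "t k = norm (xk k - xb)" for k
  have "0 \<in> \<Phi> xb" using in_gph by (simp add: gph_def)
  then have "xk k \<noteq> xb" for k using d(1)[of k] by metis
  then have t: "t k > 0" for k by (simp add: t_def)
  have "(\<lambda>k. norm (xk k - xb)) \<longlonglongrightarrow> norm (xb - xb)" by (intro tendsto_intros d(4))
  then have t0: "t \<longlonglongrightarrow> 0" by (simp add: t_def[abs_def])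
  have u: "(\<lambda>k. (1 / t k) *\<^sub>R (xk k - xb)) \<longlonglongrightarrow> u" using d(6) by (simp add: t_def)
  have yt: "(\<lambda>k. (1 / t k) *\<^sub>R yk k) \<longlonglongrightarrow> 0" using d(7) by (simp add: t_def)
  have regD: "lk k \<in> reg_normal_cone D (g (xk k) - yk k)"
    and xsk: "xsk k = adjoint (blinfun_apply (G1 (xk k))) (lk k)" for k
    using d(3)[of k] reg_normal_cone_gph_iff[of g "G1 (xk k)" "xk k" \<Phi> D "xsk k" "lk k" "yk k", OF g_deriv Phi_def]
    unfolding reg_coderiv_def by blast+
  define r where "r k = (1 / (t k)\<^sup>2) *\<^sub>R (g (xk k) - g xb - L (xk k - xb))" for k
  have r: "r \<longlonglongrightarrow> b0"
    using second_order_difference_quotient_tendsto[OF g_deriv G1_deriv t t0 u]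
    by (simp add: r_def[abs_def] b0_def L_def)
  define q where "q k = (1 / t k) *\<^sub>R (g (xk k) - yk k - g xb)" for k
  have q: "q \<longlonglongrightarrow> p"
  proof -
    have "(\<lambda>k. (1 / t k) *\<^sub>R (g (xk k) - g xb) - (1 / t k) *\<^sub>R yk k) \<longlonglongrightarrow> p - 0"
      using difference_quotient_tendsto[OF g_deriv t t0 u]
      by (intro tendsto_diff yt) (simp add: p_def L_def)
    moreover have "(1 / t k) *\<^sub>R (g (xk k) - g xb) - (1 / t k) *\<^sub>R yk k = q k" for k
      by (simp add: q_def scaleR_diff_right)
    ultimately show ?thesis by simp
  qed
  \<comment> \<open>Displacement on the second-order scale. Its decomposition separates the
    convergent \<open>r\<close> from \<open>s\<close> and \<open>v\<close>, either of which may be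
    unbounded.\<close>
  define W where "W k = (1 / t k) *\<^sub>R (q k - p)" for k
  define s where "s k = (1 / t k) *\<^sub>R ((1 / t k) *\<^sub>R (xk k - xb) - u)" for k
  define v where "v k = (1 / (t k)\<^sup>2) *\<^sub>R yk k" for k
  have W_eq: "W k = L (s k) + (r k - v k)" for k
  proof -
    have "(t k)\<^sup>2 *\<^sub>R r k = g (xk k) - g xb - L (xk k - xb)" using t[of k] by (simp add: r_def)
    then have eq: "g (xk k) - yk k - g xb = (t k)\<^sup>2 *\<^sub>R r k + L (xk k - xb) - yk k" by simp
    have "q k = t k *\<^sub>R r k + (1 / t k) *\<^sub>R L (xk k - xb) - (1 / t k) *\<^sub>R yk k"
      unfolding q_def eq using t[of k] by (simp add: scaleR_diff_right scaleR_add_right power2_eq_square)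
    then show ?thesis
      using t[of k] by (simp add: W_def s_def v_def p_def L.scaleR L.diff scaleR_diff_right scaleR_add_right power2_eq_square)
  qed
  \<comment> \<open>Normals pass from \<open>D\<close> at \<open>g xb + t q\<close> to
    \<open>C\<close> at \<open>t q\<close>, by scaling to \<open>C\<close> at
    \<open>q = p + (q - p)\<close>, then to \<open>T\<close> at \<open>q - p\<close>, and by scaling
    to \<open>T\<close> at \<open>W\<close>.\<close>
  have regT: "\<forall>\<^sub>F k in sequentially. lk k \<in> reg_normal_cone T (W k)"
  proof -
    have "(\<lambda>k. norm (t k *\<^sub>R q k)) \<longlonglongrightarrow> norm (0 *\<^sub>R p)" by (intro tendsto_intros t0 q)
    then have e1: "\<forall>\<^sub>F k in sequentially. norm (t k *\<^sub>R q k) < dD"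
      using dD(1) by (intro order_tendstoD(2)) auto
    have "(\<lambda>k. norm (q k - p)) \<longlonglongrightarrow> norm (p - p)" by (intro tendsto_intros q)
    then have e2: "\<forall>\<^sub>F k in sequentially. norm (q k - p) < dC"
      using dC(1) by (intro order_tendstoD(2)) auto
    show ?thesis
      using e1 e2
    proof eventually_elim
      case (elim k)
      have "g (xk k) - yk k = g xb + t k *\<^sub>R q k" using t[of k] by (simp add: q_def)
      then have "lk k \<in> reg_normal_cone C (t k *\<^sub>R q k)"
        using regD[of k] reg_normal_cone_translate_local[of dD "g xb" D C, OF dD(2) elim(1)] by simp
      then have "lk k \<in> reg_normal_cone C (p + (q k - p))"
        using reg_normal_cone_same_signs[OF A CA(1) same_signs_scaleR[OF t]] by simp
      then have "lk k \<in> reg_normal_cone T (q k - p)"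
        using reg_normal_cone_translate_local[of dC p C T, OF dC(2) elim(2)] by simp
      moreover have "1 / t k > 0" using t by simp
      ultimately show ?case
        unfolding W_def using reg_normal_cone_same_signs[OF A TA(1) same_signs_scaleR] by blast
    qed
  qed

  \<comment> \<open>Normalising by the maximum keeps both the scaled multiplier and
    \<open>1 / c\<close> bounded. The limit \<open>\<kappa>\<close> of \<open>1 / c\<close> then
    separates unbounded (\<open>\<kappa> = 0\<close>) from bounded \<open>t \<lambda>\<close>, after
    one extraction.\<close>
  define c where "c k = max 1 (t k * norm (lk k))" for k
  have c: "c k \<ge> 1" for k by (simp add: c_def)
  obtain r1 :: "nat \<Rightarrow> nat" and w where r1: "strict_mono r1" "\<forall>k. same_signs A (W (r1 k)) w"
    using same_signs_subsequence[OF A] .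
  define X where "X k = (t (r1 k) *\<^sub>R (1 / c (r1 k)) *\<^sub>R lk (r1 k), 1 / c (r1 k))" for k
  have "norm (X k) \<le> 2" for k
  proof -
    have "norm (t (r1 k) *\<^sub>R (1 / c (r1 k)) *\<^sub>R lk (r1 k)) \<le> 1"
      using t[of "r1 k"] c[of "r1 k"] by (simp add: pos_divide_le_eq) (simp add: c_def)
    moreover have "norm (1 / c (r1 k)) \<le> 1" using c[of "r1 k"] by simp
    ultimately show ?thesis unfolding X_def using norm_Pair_le order_trans by (metis add_mono one_add_one)
  qed
  then have "bounded (range X)" by (auto simp: bounded_iff)
  then obtain l r2 where r2: "strict_mono r2" "(X \<circ> r2) \<longlonglongrightarrow> l"
    using bounded_imp_convergent_subsequence by blast
  obtain N where N: "\<And>k. k \<ge> N \<Longrightarrow> lk k \<in> reg_normal_cone T (W k)" "\<And>k. k \<ge> N \<Longrightarrow> norm (lk k) > 0"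
    using eventually_conj[OF regT filterlim_at_top_dense[THEN iffD1, OF d(8), rule_format, of 0]]
    by (auto simp: eventually_sequentially)
  \<comment> \<open>The shift by \<open>N\<close> turns the eventual properties into properties of
    every term.\<close>
  define \<phi> where "\<phi> k = r1 (r2 (k + N))" for k
  have \<phi>: "strict_mono \<phi>" using r1(1) r2(1) by (auto simp: \<phi>_def strict_mono_def)
  have \<phi>N: "\<phi> k \<ge> N" for k
    using seq_suble[OF r1(1), of "r2 (k + N)"] seq_suble[OF r2(1), of "k + N"] by (simp add: \<phi>_def)
  define \<mu> \<kappa> where "\<mu> = fst l" and "\<kappa> = snd l"
  have X\<phi>: "(\<lambda>k. X (r2 (k + N))) \<longlonglongrightarrow> l" using LIMSEQ_ignore_initial_segment[OF r2(2), of N] by simp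
  have mu: "(\<lambda>k. t (\<phi> k) *\<^sub>R (1 / c (\<phi> k)) *\<^sub>R lk (\<phi> k)) \<longlonglongrightarrow> \<mu>"
    using tendsto_fst[OF X\<phi>] by (simp add: X_def \<mu>_def \<phi>_def)
  have kappa: "(\<lambda>k. 1 / c (\<phi> k)) \<longlonglongrightarrow> \<kappa>"
    using tendsto_snd[OF X\<phi>] by (simp add: X_def \<kappa>_def \<phi>_def)
  \<comment> \<open>The cell is represented by a member of the sequence itself, which carries a
    regular normal and hence lies in \<open>T\<close>.\<close>
  define w0 where "w0 = W (\<phi> 0)"
  define K where "K = reg_normal_cone T w0"
  have ssW: "same_signs A (W (\<phi> k)) w0" for k
    using r1(2) unfolding w0_def \<phi>_def same_signs_def by simp
  have regK: "reg_normal_cone T (W (\<phi> k)) = K" for k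
    unfolding K_def by (rule reg_normal_cone_same_signs[OF A TA(1) ssW])
  have lK: "lk (\<phi> k) \<in> K" for k using N(1)[OF \<phi>N] regK by simp
  have w0T: "w0 \<in> T" using lK unfolding K_def by (simp add: reg_normal_cone_def)
  have polyK: "polyhedron K" unfolding K_def by (rule polyhedron_reg_normal_cone[OF A TA w0T])
  have Kscale: "a *\<^sub>R m \<in> K" if "a > 0" "m \<in> K" for a m
    using that unfolding K_def by (simp add: reg_normal_cone_scaleR)
  have sub: "(f \<circ> \<phi>) \<longlonglongrightarrow> a" if "f \<longlonglongrightarrow> a" for f :: "nat \<Rightarrow> 'c::topological_space" and a
    using LIMSEQ_subseq_LIMSEQ[OF that \<phi>] .
  have Gs: "(\<lambda>k. (1 / t (\<phi> k)) *\<^sub>R (G1 (xk (\<phi> k)) - G1 xb)) \<longlonglongrightarrow> G2 xb u"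
    using sub[OF difference_quotient_tendsto[OF G1_deriv t t0 u]] by (simp add: comp_def)
  have t\<phi>: "(\<lambda>k. t (\<phi> k)) \<longlonglongrightarrow> 0" using sub[OF t0] by (simp add: comp_def)
  have xs\<phi>: "(\<lambda>k. xsk (\<phi> k)) \<longlonglongrightarrow> xst" using sub[OF d(5)] by (simp add: comp_def)
  have "\<kappa> \<ge> 0"
    by (rule LIMSEQ_le_const[OF kappa]) (use c in \<open>auto intro!: exI[of _ 0] order_trans[OF zero_le_one]\<close>)
  then consider "\<kappa> = 0" | "\<kappa> > 0" by linarith
  then show ?thesis
  proof cases
    case 1
    \<comment> \<open>The multipliers blow up faster than \<open>1 / t\<close>; their normalised limit violates the
      qualification condition.\<close>
    have "\<forall>\<^sub>F k in sequentially. 1 / c (\<phi> k) < 1" using kappa 1 by (intro order_tendstoD(2)) auto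
    then have cev: "\<forall>\<^sub>F k in sequentially. c (\<phi> k) = t (\<phi> k) * norm (lk (\<phi> k))"
    proof eventually_elim
      case (elim k)
      then have "c (\<phi> k) > 1" using c[of "\<phi> k"] by (simp add: divide_less_eq split: if_splits)
      then show ?case by (simp add: c_def max_def split: if_splits)
    qed
    have "norm \<mu> = 1"
    proof -
      have "\<forall>\<^sub>F k in sequentially. norm (t (\<phi> k) *\<^sub>R (1 / c (\<phi> k)) *\<^sub>R lk (\<phi> k)) = 1"
        using cev
      proof eventually_elim
        case (elim k)
        have "c (\<phi> k) > 0" using c[of "\<phi> k"] by linarith
        then show ?case using t[of "\<phi> k"] elim N(2)[OF \<phi>N, of k] by simp
      qed
      then have "(\<lambda>k. norm (t (\<phi> k) *\<^sub>R (1 / c (\<phi> k)) *\<^sub>R lk (\<phi> k))) \<longlonglongrightarrow> 1"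
        by (rule tendsto_eventually)
      from LIMSEQ_unique[OF this tendsto_norm[OF mu]] show ?thesis by simp
    qed
    \<comment> \<open>The norm of \<open>v\<close> is that of \<open>(norm y / t) \<lambda>\<close>,
      which converges, divided by \<open>t\<close> times the norm of \<open>\<lambda>\<close>, which
      tends to infinity.\<close>
    have v0: "(\<lambda>k. v (\<phi> k)) \<longlonglongrightarrow> 0"
    proof (rule tendsto_norm_zero_cancel)
      have "(\<lambda>k. norm ((norm (yk (\<phi> k)) / t (\<phi> k)) *\<^sub>R lk (\<phi> k)) * (1 / c (\<phi> k))) \<longlonglongrightarrow> norm yst * \<kappa>"
        using sub[OF d(10)] by (intro tendsto_mult tendsto_norm kappa) (simp add: comp_def t_def)
      moreover have "\<forall>\<^sub>F k in sequentially. norm ((norm (yk (\<phi> k)) / t (\<phi> k)) *\<^sub>R lk (\<phi> k)) * (1 / c (\<phi> k)) = norm (v (\<phi> k))"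
        using cev
      proof eventually_elim
        case (elim k)
        have "norm (lk (\<phi> k)) > 0" using N(2)[OF \<phi>N] .
        then show ?case using t[of "\<phi> k"] unfolding elim by (auto simp: v_def power2_eq_square)
      qed
      ultimately show "(\<lambda>k. norm (v (\<phi> k))) \<longlonglongrightarrow> 0" using 1 by (simp add: tendsto_cong)
    qed
    have "(\<lambda>k. r (\<phi> k) - v (\<phi> k)) \<longlonglongrightarrow> b0 - 0"
      using sub[OF r] by (intro tendsto_diff v0) (simp add: comp_def)
    then have bl: "(\<lambda>k. r (\<phi> k) - v (\<phi> k)) \<longlonglongrightarrow> b0" by simp
    obtain s0 where s0: "K \<subseteq> lim_normal_cone T (L s0 + b0)"
      using sign_cell_limit_normal_cone[OF A TA L.linear w0T ssW[unfolded W_eq] bl] unfolding K_def by blast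
    \<comment> \<open>Division by \<open>c\<close> sends the convergent \<open>xsk\<close> to zero,
      which matches the zero left-hand side of the qualification condition.\<close>
    have x0: "(\<lambda>k. adjoint (blinfun_apply (G1 (xk (\<phi> k)))) ((1 / c (\<phi> k)) *\<^sub>R lk (\<phi> k))) \<longlonglongrightarrow> 0"
      using tendsto_scaleR[OF kappa xs\<phi>] 1 by (simp add: linear_scale[OF linear_adjoint_blinfun] xsk)
    have mK: "t (\<phi> k) *\<^sub>R (1 / c (\<phi> k)) *\<^sub>R lk (\<phi> k) \<in> K" for k
    proof -
      have "1 / c (\<phi> k) > 0" using c[of "\<phi> k"] by simp
      then show ?thesis using Kscale t lK by blast
    qed
    note M = scaled_multiplier_limit[OF polyK t t\<phi> mK mu Gs x0]
    obtain z where z: "z \<in> tangent_cone K \<mu>" "0 = adjoint (blinfun_apply (G2 xb u)) \<mu> + adjoint L z"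
      using M(3) unfolding adjL by blast
    have "\<mu> = 0"
      by (rule qual[rule_format, OF multiplier_systemI[OF s0 M(1,2) z[unfolded adjL]]])
    then show ?thesis using \<open>norm \<mu> = 1\<close> by simp
  next
    case 2
    define m where "m = (1 / \<kappa>) *\<^sub>R \<mu>"
    have ml: "(\<lambda>k. t (\<phi> k) *\<^sub>R lk (\<phi> k)) \<longlonglongrightarrow> m"
    proof -
      have "(\<lambda>k. (1 / (1 / c (\<phi> k))) *\<^sub>R (t (\<phi> k) *\<^sub>R (1 / c (\<phi> k)) *\<^sub>R lk (\<phi> k))) \<longlonglongrightarrow> m"
        unfolding m_def using 2 by (intro tendsto_scaleR tendsto_divide kappa mu tendsto_const) auto
      moreover have "(\<lambda>k. (1 / (1 / c (\<phi> k))) *\<^sub>R (t (\<phi> k) *\<^sub>R (1 / c (\<phi> k)) *\<^sub>R lk (\<phi> k)))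
          = (\<lambda>k. t (\<phi> k) *\<^sub>R lk (\<phi> k))"
      proof
        fix k
        have "c (\<phi> k) \<noteq> 0" using c[of "\<phi> k"] by linarith
        then show "(1 / (1 / c (\<phi> k))) *\<^sub>R (t (\<phi> k) *\<^sub>R (1 / c (\<phi> k)) *\<^sub>R lk (\<phi> k)) = t (\<phi> k) *\<^sub>R lk (\<phi> k)"
          by simp
      qed
      ultimately show ?thesis by (simp only:)
    qed
    have mK: "t (\<phi> k) *\<^sub>R lk (\<phi> k) \<in> K" for k using Kscale t lK by blast
    have x0: "(\<lambda>k. adjoint (blinfun_apply (G1 (xk (\<phi> k)))) (lk (\<phi> k))) \<longlonglongrightarrow> xst"
      using xs\<phi> by (simp add: xsk)
    note M = scaled_multiplier_limit[OF polyK t t\<phi> mK ml Gs x0]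
    obtain z where z: "z \<in> tangent_cone K m" "xst = adjoint (blinfun_apply (G2 xb u)) m + adjoint L z"
      using M(3) unfolding adjL by blast
    have Lm: "inner m (L h) = 0" for h using M(2) inner_adj[of m h] by (simp add: adjL)
    have orth: "inner m (W (\<phi> k)) = 0" for k
    proof (rule reg_normal_cone_orthogonal)
      show "m \<in> reg_normal_cone T (W (\<phi> k))" using M(1) regK by simp
      show "a *\<^sub>R x \<in> T" if "a > 0" "x \<in> T" for a x
        using sign_determined_scaleR_iff[OF TA(1)] that by blast
    qed
    \<comment> \<open>Since \<open>m\<close> is orthogonal to \<open>W\<close> and to the range of
      \<open>L\<close>, the possibly divergent term \<open>L (s k)\<close> drops out of the
      decomposition of \<open>W\<close>.\<close>
    have rv: "inner m (r (\<phi> k)) = (1 / (t (\<phi> k))\<^sup>2) * inner m (yk (\<phi> k))" for k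
      using orth[of k] unfolding W_eq by (simp add: inner_add_right inner_diff_right Lm v_def)
    \<comment> \<open>For nonzero \<open>m\<close> the normalised multipliers tend to the direction
      of \<open>m\<close>, and by alignment so do the normalised \<open>y\<close>. Hence
      \<open>inner m y\<close>, and with it \<open>inner m r\<close>, is eventually
      nonnegative.\<close>
    have mb: "inner m b0 \<ge> 0"
    proof (cases "m = 0")
      case False
      have nm: "norm m > 0" using False by simp
      have "(\<lambda>k. (1 / norm (t (\<phi> k) *\<^sub>R lk (\<phi> k))) *\<^sub>R (t (\<phi> k) *\<^sub>R lk (\<phi> k))) \<longlonglongrightarrow> (1 / norm m) *\<^sub>R m"
        using nm by (intro tendsto_scaleR tendsto_divide tendsto_norm ml tendsto_const) auto
      moreover have "(\<lambda>k. (1 / norm (t (\<phi> k) *\<^sub>R lk (\<phi> k))) *\<^sub>R (t (\<phi> k) *\<^sub>R lk (\<phi> k)))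
          = (\<lambda>k. (1 / norm (lk (\<phi> k))) *\<^sub>R lk (\<phi> k))"
      proof
        show "(1 / norm (t (\<phi> k) *\<^sub>R lk (\<phi> k))) *\<^sub>R (t (\<phi> k) *\<^sub>R lk (\<phi> k)) = (1 / norm (lk (\<phi> k))) *\<^sub>R lk (\<phi> k)" for k
          using t[of "\<phi> k"] by simp
      qed
      ultimately have ll: "(\<lambda>k. (1 / norm (lk (\<phi> k))) *\<^sub>R lk (\<phi> k)) \<longlonglongrightarrow> (1 / norm m) *\<^sub>R m" by (simp only:)
      have "(\<lambda>k. (1 / norm (yk (\<phi> k))) *\<^sub>R yk (\<phi> k) - (1 / norm (lk (\<phi> k))) *\<^sub>R lk (\<phi> k)) \<longlonglongrightarrow> 0"
        using sub[OF d(9)] by (simp add: comp_def)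
      from tendsto_add[OF this ll]
      have "(\<lambda>k. (1 / norm (yk (\<phi> k))) *\<^sub>R yk (\<phi> k)) \<longlonglongrightarrow> (1 / norm m) *\<^sub>R m" by simp
      from tendsto_inner[OF tendsto_const this, of m]
      have "(\<lambda>k. (1 / norm (yk (\<phi> k))) * inner m (yk (\<phi> k))) \<longlonglongrightarrow> norm m"
        using nm by (simp add: dot_square_norm power2_eq_square)
      then have "\<forall>\<^sub>F k in sequentially. (1 / norm (yk (\<phi> k))) * inner m (yk (\<phi> k)) > 0"
        using nm by (intro order_tendstoD(1))
      then have "\<forall>\<^sub>F k in sequentially. inner m (r (\<phi> k)) \<ge> 0"
      proof eventually_elim
        case (elim k)
        then have "inner m (yk (\<phi> k)) > 0" using d(2)[of "\<phi> k"] by (simp add: zero_less_divide_iff)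
        then show ?case using t[of "\<phi> k"] unfolding rv by simp
      qed
      moreover have "(\<lambda>k. inner m (r (\<phi> k))) \<longlonglongrightarrow> inner m b0"
        using sub[OF r] by (intro tendsto_inner tendsto_const) (simp add: comp_def)
      ultimately show ?thesis by (intro tendsto_lowerbound[of _ _ sequentially 0]) auto
    qed simp
    \<comment> \<open>With \<open>s = 0\<close> and \<open>v = b0 - w0\<close> the base point is
      \<open>w0\<close>, where \<open>K\<close> consists of regular normals, so no limit of
      \<open>s k\<close> or \<open>v k\<close> is required. Orthogonality of \<open>m\<close> to
      \<open>w0\<close> reduces the sign condition to \<open>inner m b0 \<ge> 0\<close>.\<close>
    have w0: "L 0 + b0 - (b0 - w0) = w0" by (simp add: L.zero)
    have KN: "K \<subseteq> lim_normal_cone T (L 0 + b0 - (b0 - w0))"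
      unfolding w0 K_def by (rule reg_normal_cone_subset_lim)
    have "inner m (b0 - w0) \<ge> 0" using mb orth[of 0] by (simp add: inner_diff_right w0_def)
    moreover have "multiplier_system (G1 xb) (G2 xb) u T (L 0 + b0 - (b0 - w0)) xst m z"
      by (rule multiplier_systemI[OF KN M(1,2) z[unfolded adjL]])
    ultimately show ?thesis by blast
  qed
qed

section \<open>From multipliers back to coderivatives\<close>

text \<open>Keeping \<open>x = xb\<close> fixed and letting \<open>y = g xb - d\<close> follow the
  approximating points of \<open>D\<close> lifts each normal of \<open>D\<close> to the
  graph.\<close>

lemma lim_coderiv_constraint_mapping:
  fixes g :: "'a::euclidean_space \<Rightarrow> 'b::euclidean_space"
  assumes g: "(g has_derivative blinfun_apply G) (at xb)"
    and Phi_def: "\<And>x. \<Phi> x = {g x - d | d. d \<in> D}"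
    and l: "l \<in> lim_normal_cone D (g xb)"
  shows "adjoint (blinfun_apply G) l \<in> lim_coderiv \<Phi> xb 0 l"
proof -
  obtain ds ls where s: "\<forall>k. ds k \<in> D" "ds \<longlonglongrightarrow> g xb" "ls \<longlonglongrightarrow> l" "\<forall>k. ls k \<in> reg_normal_cone D (ds k)"
    using l unfolding lim_normal_cone_def by blast
  have D: "g xb \<in> D" using l by (simp add: lim_normal_cone_def)
  have mem: "(xb, g xb - d) \<in> gph \<Phi>" if "d \<in> D" for d using that by (auto simp: gph_def Phi_def)
  let ?p = "\<lambda>k. (xb, g xb - ds k)" and ?n = "\<lambda>k. (adjoint (blinfun_apply G) (ls k), - ls k)"
  have "?p \<longlonglongrightarrow> (xb, g xb - g xb)" by (intro tendsto_intros s)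
  moreover have "?n \<longlonglongrightarrow> (adjoint (blinfun_apply G) l, - l)"
    by (intro tendsto_intros s tendsto_adjoint_blinfun)
  moreover have "\<forall>k. ?n k \<in> reg_normal_cone (gph \<Phi>) (?p k)"
    unfolding reg_normal_cone_gph_iff[OF g Phi_def] using s(4) by simp
  moreover have "\<forall>k. ?p k \<in> gph \<Phi>" "(xb, 0) \<in> gph \<Phi>" using mem s(1) mem[OF D] by simp_all
  ultimately show ?thesis
    unfolding lim_coderiv_def lim_normal_cone_def
    by (intro CollectI conjI exI[of _ ?p] exI[of _ ?n]) simp_all
qed

text \<open>Points move exactly along \<open>u\<close>, and the \<open>y\<close>-component is
  adjusted so that \<open>g x - y\<close> equals \<open>g xb + t ps\<close>. There \<open>D\<close>
  is conic, so its normals are those of \<open>C\<close> at \<open>ps\<close>.\<close>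

lemma dir_coderiv_constraint_mapping:
  fixes g :: "'a::euclidean_space \<Rightarrow> 'b::euclidean_space"
  assumes g: "\<And>x. (g has_derivative blinfun_apply (G1 x)) (at x)" and G1: "isCont G1 xb"
    and D: "closed D" "polyhedral_near D (g xb)"
    and Phi_def: "\<And>x. \<Phi> x = {g x - d | d. d \<in> D}"
    and l: "l \<in> lim_normal_cone (tangent_cone D (g xb)) (G1 xb u)"
  shows "adjoint (blinfun_apply (G1 xb)) l \<in> dir_coderiv \<Phi> xb 0 u 0 l"
proof -
  define C where "C = tangent_cone D (g xb)"
  obtain A where A: "finite A" and CA: "sign_determined A C" "closed C"
    and locD: "\<exists>d>0. \<forall>h. norm h < d \<longrightarrow> (g xb + h \<in> D \<longleftrightarrow> h \<in> C)"
    using tangent_cone_polyhedral_near[OF D] unfolding C_def by blast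
  obtain \<delta> where \<delta>: "\<delta> > 0" "\<And>h. norm h < \<delta> \<Longrightarrow> g xb + h \<in> D \<longleftrightarrow> h \<in> C" using locD by blast
  obtain ps ls where s: "ps \<longlonglongrightarrow> G1 xb u" "ls \<longlonglongrightarrow> l" "\<And>k. ls k \<in> reg_normal_cone C (ps k)"
    using l unfolding lim_normal_cone_def C_def by blast
  have "bounded (range ps)" using s(1) convergent_imp_bounded by blast
  then obtain B where B: "B > 0" "\<And>k. norm (ps k) \<le> B" by (auto simp: bounded_pos)
  \<comment> \<open>The factor \<open>\<delta> / (2 * B)\<close> keeps
    \<open>t k *\<^sub>R ps k\<close> inside the conic neighbourhood for every
    \<open>k\<close>.\<close>
  define t where "t k = (\<delta> / (2 * B)) * (1 / real (Suc k))" for k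
  have t: "t k > 0" for k using \<delta> B by (simp add: t_def)
  have "t \<longlonglongrightarrow> (\<delta> / (2 * B)) * 0"
    unfolding t_def using LIMSEQ_inverse_real_of_nat by (intro tendsto_intros) (simp add: inverse_eq_divide)
  then have t0: "t \<longlonglongrightarrow> 0" by simp
  have small: "norm (t k *\<^sub>R ps k) < \<delta>" for k
  proof -
    have "t k \<le> \<delta> / (2 * B) * 1" unfolding t_def using \<delta> B by (intro mult_left_mono) auto
    then have "t k * norm (ps k) \<le> \<delta> / (2 * B) * B" using B t[of k] by (intro mult_mono) auto
    also have "\<dots> < \<delta>" using B \<delta> by simp
    finally show ?thesis using t[of k] by simp
  qed
  define x where "x k = xb + t k *\<^sub>R u" for k
  \<comment> \<open>Both terms tend to the derivative of \<open>g\<close> in direction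
    \<open>u\<close>, so the \<open>y\<close>-component of the direction vanishes in the
    limit.\<close>
  define v where "v k = (1 / t k) *\<^sub>R (g (x k) - g xb) - ps k" for k
  have xu: "(1 / t k) *\<^sub>R (x k - xb) = u" for k using t[of k] by (simp add: x_def)
  have "(\<lambda>k. (1 / t k) *\<^sub>R (x k - xb)) \<longlonglongrightarrow> u" unfolding xu by simp
  from tendsto_diff[OF difference_quotient_tendsto[OF g t t0 this] s(1)]
  have v0: "v \<longlonglongrightarrow> 0" by (simp add: v_def[abs_def])
  have "(\<lambda>k. xb + t k *\<^sub>R u) \<longlonglongrightarrow> xb + 0 *\<^sub>R u" by (intro tendsto_intros t0)
  then have xxb: "x \<longlonglongrightarrow> xb" by (simp add: x_def[abs_def])
  have Gx: "(\<lambda>k. G1 (x k)) \<longlonglongrightarrow> G1 xb" by (rule isCont_tendsto_compose[OF G1 xxb])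
  let ?n = "\<lambda>k. (adjoint (blinfun_apply (G1 (x k))) (ls k), - ls k)" and ?d = "\<lambda>k. (u, v k)"
  have "?n k \<in> reg_normal_cone (gph \<Phi>) ((xb, 0) + t k *\<^sub>R ?d k)" for k
  proof -
    have "g (x k) - t k *\<^sub>R v k = g xb + t k *\<^sub>R ps k"
      using t[of k] by (simp add: v_def scaleR_diff_right)
    moreover have "reg_normal_cone D (g xb + t k *\<^sub>R ps k) = reg_normal_cone C (t k *\<^sub>R ps k)"
      by (rule reg_normal_cone_translate_local[OF \<delta>(2) small])
    moreover have "\<dots> = reg_normal_cone C (ps k)"
      by (rule reg_normal_cone_same_signs[OF A CA(1) same_signs_scaleR[OF t]])
    ultimately have "ls k \<in> reg_normal_cone D (g (x k) - t k *\<^sub>R v k)" using s(3) by simp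
    then have "?n k \<in> reg_normal_cone (gph \<Phi>) (x k, t k *\<^sub>R v k)"
      unfolding reg_normal_cone_gph_iff[OF g Phi_def] by simp
    then show ?thesis by (simp add: x_def)
  qed
  moreover have "?n \<longlonglongrightarrow> (adjoint (blinfun_apply (G1 xb)) l, - l)"
    by (intro tendsto_intros s tendsto_adjoint_blinfun Gx)
  moreover have "?d \<longlonglongrightarrow> (u, 0)" by (intro tendsto_intros v0)
  ultimately show ?thesis
    unfolding dir_coderiv_def dir_normal_cone_def using t t0
    by (intro CollectI exI[of _ t] exI[of _ ?d] exI[of _ ?n] conjI) simp_all
qed

theorem mainTheorem13:
  fixes g :: "'a::euclidean_space \<Rightarrow> real ^ 'm"
    and G1 :: "'a \<Rightarrow> ('a \<Rightarrow>\<^sub>L (real ^ 'm))"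
    and G2 :: "'a \<Rightarrow> ('a \<Rightarrow>\<^sub>L 'a \<Rightarrow>\<^sub>L (real ^ 'm))"
    and D :: "(real ^ 'm) set"
    and \<Phi> :: "'a \<Rightarrow> (real ^ 'm) set"
    and xb u :: 'a
  assumes g_deriv: "\<And>x. (g has_derivative blinfun_apply (G1 x)) (at x)"
    and G1_deriv: "\<And>x. (G1 has_derivative blinfun_apply (G2 x)) (at x)"
    and G2_cont: "continuous_on UNIV G2"
    and D_closed: "closed D"
    and D_poly: "polyhedral_near D (g xb)"
    and Phi_def: "\<And>x. \<Phi> x = {g x - d | d. d \<in> D}"
    and in_gph: "(xb, 0) \<in> gph \<Phi>"
    and u_unit: "norm u = 1"
    and qual: "\<And>s ys zs.
       adjoint (blinfun_apply (G1 xb)) ys = 0 \<Longrightarrow>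
       hess_apply (G2 xb) ys u + adjoint (blinfun_apply (G1 xb)) zs = 0 \<Longrightarrow>
       ys \<in> lim_normal_cone (tangent_cone (tangent_cone D (g xb)) (G1 xb u))
               (G1 xb s + (1/2) *\<^sub>R (G2 xb u u)) \<Longrightarrow>
       zs \<in> tangent_cone (lim_normal_cone (tangent_cone (tangent_cone D (g xb)) (G1 xb u))
               (G1 xb s + (1/2) *\<^sub>R (G2 xb u u))) ys \<Longrightarrow>
       ys = 0"
  shows
   "((\<forall>xs s ys zs v.
        inner ys v \<ge> 0
      \<and> xs = hess_apply (G2 xb) ys u + adjoint (blinfun_apply (G1 xb)) zs
      \<and> ys \<in> lim_normal_cone (tangent_cone (tangent_cone D (g xb)) (G1 xb u))
               (G1 xb s + (1/2) *\<^sub>R (G2 xb u u) - v)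
      \<and> adjoint (blinfun_apply (G1 xb)) ys = 0
      \<and> zs \<in> tangent_cone (lim_normal_cone (tangent_cone (tangent_cone D (g xb)) (G1 xb u))
               (G1 xb s + (1/2) *\<^sub>R (G2 xb u u) - v)) ys
      \<longrightarrow> (\<exists>l \<in> lim_normal_cone D (g xb). xs = adjoint (blinfun_apply (G1 xb)) l))
     \<longrightarrow> asym_regular \<Phi> xb 0 u)
  \<and> ((\<forall>xs s ys zs v.
        inner ys v \<ge> 0
      \<and> xs = hess_apply (G2 xb) ys u + adjoint (blinfun_apply (G1 xb)) zs
      \<and> ys \<in> lim_normal_cone (tangent_cone (tangent_cone D (g xb)) (G1 xb u))
               (G1 xb s + (1/2) *\<^sub>R (G2 xb u u) - v)
      \<and> adjoint (blinfun_apply (G1 xb)) ys = 0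
      \<and> zs \<in> tangent_cone (lim_normal_cone (tangent_cone (tangent_cone D (g xb)) (G1 xb u))
               (G1 xb s + (1/2) *\<^sub>R (G2 xb u u) - v)) ys
      \<longrightarrow> (\<exists>l \<in> lim_normal_cone (tangent_cone D (g xb)) (G1 xb u).
             xs = adjoint (blinfun_apply (G1 xb)) l))
     \<longrightarrow> strong_asym_regular \<Phi> xb 0 u)"
proof -
  let ?T = "tangent_cone (tangent_cone D (g xb)) (G1 xb u)" and ?b = "(1/2) *\<^sub>R G2 xb u u"
  have "\<forall>s ys zs. multiplier_system (G1 xb) (G2 xb) u ?T (G1 xb s + ?b) 0 ys zs \<longrightarrow> ys = 0"
  proof (intro allI impI)
    show "ys = 0" if "multiplier_system (G1 xb) (G2 xb) u ?T (G1 xb s + ?b) 0 ys zs" for s ys zs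
      using that unfolding multiplier_system_def by (intro qual[of ys zs s]) simp_all
  qed
  note system = asym_seq_data_multiplier_system[where g = g and ?G1.0 = G1 and ?G2.0 = G2
      and xb = xb and u = u and D = D, OF g_deriv G1_deriv D_closed D_poly
      Phi_def in_gph this, unfolded multiplier_system_def]
  have cont: "isCont G1 xb" using has_derivative_continuous[OF G1_deriv] by simp
  show ?thesis
  proof (intro conjI impI, goal_cases)
    case 1
    show "asym_regular \<Phi> xb 0 u"
      unfolding asym_regular_def
    proof (intro allI impI)
      fix xk yk xsk lk xst yst assume "asym_seq_data \<Phi> xb 0 u xk yk xsk lk xst yst"
      from system[OF this]
      have "\<exists>l \<in> lim_normal_cone D (g xb). xst = adjoint (blinfun_apply (G1 xb)) l"
        by (elim exE) (rule 1[rule_format])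
      then show "xst \<in> (\<Union>l. lim_coderiv \<Phi> xb 0 l)"
        using lim_coderiv_constraint_mapping[OF g_deriv Phi_def] by blast
    qed
  next
    case 2
    show "strong_asym_regular \<Phi> xb 0 u"
      unfolding strong_asym_regular_def
    proof (intro allI impI)
      fix xk yk xsk lk xst yst assume "asym_seq_data \<Phi> xb 0 u xk yk xsk lk xst yst"
      from system[OF this]
      have "\<exists>l \<in> lim_normal_cone (tangent_cone D (g xb)) (G1 xb u).
          xst = adjoint (blinfun_apply (G1 xb)) l"
        by (elim exE) (rule 2[rule_format])
      then show "xst \<in> (\<Union>l. dir_coderiv \<Phi> xb 0 u 0 l)"
        using dir_coderiv_constraint_mapping[OF g_deriv cont D_closed D_poly Phi_def] by blast
    qed
  qed
qed

end
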